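(* Let $P$ and $R$ be two general logic programs such that $P$ extends $R$, let $M$ be a complete model of $P\cup R$, and let $\mathcal{C}$ be a $(P\cup R)$-closed class of queries. Suppose that (1) $P$ is acceptable with respect to a level mapping $|\ |$ and $M$; (2) for all queries $Q\in\mathcal{C}$, all LDNF-derivations of $R\cup\{Q\}$ are finite; (3) for all atoms $A\in\mathcal{C}$, if $A$ is defined in $P$ then $A$ is bounded with respect to $|\ |$. Then for all queries $Q\in\mathcal{C}$, all LDNF-derivations of $(P\cup R)\cup\{Q\}$ are finite.
   Context: **Programs.** All programs and queries are over a fixed first-order language with at least one constant. A literal is an atom or a negated atom. A (general) clause is $H\leftarrow L_1,\ldots,L_n$ ($n\ge 0$), $H$ an atom, $L_i$ literals. A (general) query is a finite, possibly empty, sequence of literals; a non-empty prefix of $L_1,\ldots,L_n$ is any $L_1,\ldots,L_i$ with $1\le i\le n$. A (general) program is a finite set of clauses. $\mathit{rel}(L)$ is the predicate symbol of $L$. $B_P$ is the set of ground atoms whose predicate symbol occurs in $P$; $\mathit{ground}(P)$ is the set of ground instances of clauses of $P$. **LDNF-resolution (leftmost selection rule).** For a program $P$ and a non-empty query $Q=L,\mathbf{L}$: (i) if $L=A$ is an atom, the resolvents of $Q$ are the queries $(\mathbf{B},\mathbf{L})\theta$ for $H\leftarrow\mathbf{B}$ a variant of a clause of $P$ renamed apart from $Q$ and $\theta=\mathrm{mgu}(A,H)$; (ii) if $L=\neg A$ with $A$ ground, a subsidiary LDNF-tree for $P\cup\{A\}$ is constructed; if this tree is finite and finitely failed, $Q$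 has the single resolvent $\mathbf{L}$; if it is finite and has a successful branch, $Q$ fails; if its construction diverges, the derivation containing $Q$ is considered infinite; (iii) if $L=\neg A$ with $A$ non-ground, the derivation flounders: it ends (finitely) with no resolvent. A branch is successful if it ends in the empty query; it is failed if it ends in a query whose first literal is positive with no resolvent, or negative and ground with a finite subsidiary tree having a successful branch. A tree is finitely failed if it is finite and all its branches are failed. The branches of the LDNF-tree of $P\cup\{Q\}$ are its LDNF-derivations. The LDNF-descendants of $P\cup\{Q\}$ are all queries occurring during LDNF-resolution of $P\cup\{Q\}$, including $Q$ itself and all queries occurring in the construction of all (nested) subsidiary LDNF-trees. "All LDNF-derivations of $P\cup\{Q\}$ are finite" means that the interpreter terminates: there is no infinite sequence $Q=Q_0,Q_1,Q_2,\ldots$ where each $Q_{k+1}$ is a resolvent of $Q_k$ or, if $Q_k$ begins with a ground negative literal $\neg A$, the root $A$ of its subsidiary tree. **Level mappings, boundedness.** A level mapping for $P$ is a function $|\ |:B_P\to\mathbf{N}$, extended to ground literals by $|\neg A|=|A|$. An atom $A$ is bounded w.r.t. $|\ |$ if $\{|A'| : A' \text{ a ground instance of } A\}$ is finite. **Complete model.** $p$ refers to $q$ if some clause of $P$ has $p$ in its head and $q$ in its body; "depends on" is the reflexive transitive closure of "refers to". $\mathit{Neg}_P$ is the set of relations occurring in a negative literal in a clause of $P$; $\mathit{Neg}^*_P$ is the set of relations on which relations in $\mathit{Neg}_P$ depend; $P^-$ is the set of clauses of $P$ defining relations in $\mathit{Neg}^*_P$. A model $M$ of $P$ is complete if its restriction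 to the relations in $\mathit{Neg}^*_P$ is a model of Clark's completion $\mathit{comp}(P^-)$ (with the free equality axioms; a relation in $\mathit{Neg}^*_P$ having no clauses is completed by $\forall \mathbf{x}\,\neg p(\mathbf{x})$). **Acceptability.** Let $|\ |$ be a level mapping for $P$ and $M$ a complete model (here: of the whole program $P\cup R$). $P$ is acceptable w.r.t. $|\ |$ and $M$ if for every clause $A\leftarrow\mathbf{A},B,\mathbf{B}$ in $\mathit{ground}(P)$ (with $B$ a literal and $\mathbf{A},\mathbf{B}$ sequences of literals): if $M\models\mathbf{A}$ then $|A|>|B|$. **Extension.** A relation is defined in $P$ if it occurs in the head of a clause of $P$; a literal $L$ is defined in $P$ if $\mathit{rel}(L)$ is. $P$ extends $R$ if no relation defined in $P$ occurs in $R$. **Closed class.** A class $\mathcal{C}$ of queries is $P$-closed if it contains all non-empty prefixes of its elements and, for each $Q\in\mathcal{C}$, every LDNF-descendant of $P\cup\{Q\}$ belongs to $\mathcal{C}$. *)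

theory Defs
  imports Main
begin

section \<open>Syntax\<close>

text \<open>
  A first-order language: the function symbols are the elements of \<open>'f\<close>, the predicate symbols
  those of \<open>'p\<close>, each with a fixed arity. The datatypes below do not enforce arities; expressions of
  the language are the well-formed ones.
\<close>

record ('f, 'p) lang =
  fun_arity :: "'f \<Rightarrow> nat"
  pred_arity :: "'p \<Rightarrow> nat"

definition has_constant :: "('f, 'p) lang \<Rightarrow> bool" where
  "has_constant \<Sigma> \<longleftrightarrow> (\<exists>c. fun_arity \<Sigma> c = 0)"

datatype 'f trm = Var nat | Fun 'f "'f trm list"

datatype ('f, 'p) atom = Atom (pred: 'p) (args: "'f trm list")

datatype ('f, 'p) literal = Pos (atom_of: "('f, 'p) atom") | Neg (atom_of: "('f, 'p) atom")

type_synonym ('f, 'p) query = "('f, 'p) literal list"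

datatype ('f, 'p) clause = Clause (head: "('f, 'p) atom") (body: "('f, 'p) query")

abbreviation rel :: "('f, 'p) literal \<Rightarrow> 'p" where
  "rel l \<equiv> pred (atom_of l)"

fun wf_trm :: "('f, 'p) lang \<Rightarrow> 'f trm \<Rightarrow> bool" where
  "wf_trm \<Sigma> (Var x) \<longleftrightarrow> True"
| "wf_trm \<Sigma> (Fun f ts) \<longleftrightarrow> length ts = fun_arity \<Sigma> f \<and> (\<forall>t\<in>set ts. wf_trm \<Sigma> t)"

definition wf_atom :: "('f, 'p) lang \<Rightarrow> ('f, 'p) atom \<Rightarrow> bool" where
  "wf_atom \<Sigma> a \<longleftrightarrow> length (args a) = pred_arity \<Sigma> (pred a) \<and> (\<forall>t\<in>set (args a). wf_trm \<Sigma> t)"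

definition wf_query :: "('f, 'p) lang \<Rightarrow> ('f, 'p) query \<Rightarrow> bool" where
  "wf_query \<Sigma> q \<longleftrightarrow> (\<forall>l\<in>set q. wf_atom \<Sigma> (atom_of l))"

definition wf_clause :: "('f, 'p) lang \<Rightarrow> ('f, 'p) clause \<Rightarrow> bool" where
  "wf_clause \<Sigma> c \<longleftrightarrow> wf_atom \<Sigma> (head c) \<and> wf_query \<Sigma> (body c)"

definition program :: "('f, 'p) lang \<Rightarrow> ('f, 'p) clause set \<Rightarrow> bool" where
  "program \<Sigma> P \<longleftrightarrow> finite P \<and> (\<forall>c\<in>P. wf_clause \<Sigma> c)"

fun vars_trm :: "'f trm \<Rightarrow> nat set" where
  "vars_trm (Var x) = {x}"
| "vars_trm (Fun f ts) = (\<Union>t\<in>set ts. vars_trm t)"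

definition vars_atom :: "('f, 'p) atom \<Rightarrow> nat set" where
  "vars_atom a = (\<Union>t\<in>set (args a). vars_trm t)"

definition vars_query :: "('f, 'p) query \<Rightarrow> nat set" where
  "vars_query q = (\<Union>l\<in>set q. vars_atom (atom_of l))"

definition vars_clause :: "('f, 'p) clause \<Rightarrow> nat set" where
  "vars_clause c = vars_atom (head c) \<union> vars_query (body c)"


section \<open>Substitutions, variants and most general unifiers\<close>

type_synonym 'f subst = "nat \<Rightarrow> 'f trm"

fun subst_trm :: "'f subst \<Rightarrow> 'f trm \<Rightarrow> 'f trm" where
  "subst_trm \<sigma> (Var x) = \<sigma> x"
| "subst_trm \<sigma> (Fun f ts) = Fun f (map (subst_trm \<sigma>) ts)"

definition subst_atom :: "'f subst \<Rightarrow> ('f, 'p) atom \<Rightarrow> ('f, 'p) atom" where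
  "subst_atom \<sigma> a = Atom (pred a) (map (subst_trm \<sigma>) (args a))"

fun subst_lit :: "'f subst \<Rightarrow> ('f, 'p) literal \<Rightarrow> ('f, 'p) literal" where
  "subst_lit \<sigma> (Pos a) = Pos (subst_atom \<sigma> a)"
| "subst_lit \<sigma> (Neg a) = Neg (subst_atom \<sigma> a)"

definition subst_query :: "'f subst \<Rightarrow> ('f, 'p) query \<Rightarrow> ('f, 'p) query" where
  "subst_query \<sigma> q = map (subst_lit \<sigma>) q"

definition subst_clause :: "'f subst \<Rightarrow> ('f, 'p) clause \<Rightarrow> ('f, 'p) clause" where
  "subst_clause \<sigma> c = Clause (subst_atom \<sigma> (head c)) (subst_query \<sigma> (body c))"

definition variant :: "('f, 'p) clause \<Rightarrow> ('f, 'p) clause \<Rightarrow> bool" where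
  "variant c c' \<longleftrightarrow> (\<exists>\<rho>. bij \<rho> \<and> c' = subst_clause (\<lambda>x. Var (\<rho> x)) c)"

definition unifier :: "'f subst \<Rightarrow> ('f, 'p) atom \<Rightarrow> ('f, 'p) atom \<Rightarrow> bool" where
  "unifier \<sigma> a b \<longleftrightarrow> subst_atom \<sigma> a = subst_atom \<sigma> b"

text \<open>
  Substitutions are arbitrary functions, neither finitely supported nor well-formed. For well-formed
  atoms this does not enlarge the set of resolvents: any most general unifier in this sense
  is a renaming of the usual finite one, and a renaming acts on a query as a finite permutation.
\<close>

definition mgu :: "'f subst \<Rightarrow> ('f, 'p) atom \<Rightarrow> ('f, 'p) atom \<Rightarrow> bool" where
  "mgu \<theta> a b \<longleftrightarrow> unifier \<theta> a b \<and>
     (\<forall>\<sigma>. unifier \<sigma> a b \<longrightarrow> (\<exists>\<gamma>. \<forall>x. \<sigma> x = subst_trm \<gamma> (\<theta> x)))"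

definition ground_atom :: "('f, 'p) atom \<Rightarrow> bool" where
  "ground_atom a \<longleftrightarrow> vars_atom a = {}"

definition ground_instances :: "('f, 'p) lang \<Rightarrow> ('f, 'p) atom \<Rightarrow> ('f, 'p) atom set" where
  "ground_instances \<Sigma> a = {a'. (\<exists>\<sigma>. a' = subst_atom \<sigma> a) \<and> wf_atom \<Sigma> a' \<and> ground_atom a'}"

definition ground :: "('f, 'p) lang \<Rightarrow> ('f, 'p) clause set \<Rightarrow> ('f, 'p) clause set" where
  "ground \<Sigma> P =
     {c'. (\<exists>c\<in>P. \<exists>\<sigma>. c' = subst_clause \<sigma> c) \<and> wf_clause \<Sigma> c' \<and> vars_clause c' = {}}"


section \<open>LDNF-resolution\<close>

inductive resolvent ::
  "('f, 'p) clause set \<Rightarrow> ('f, 'p) atom \<Rightarrow> ('f, 'p) query \<Rightarrow> ('f, 'p) query \<Rightarrow> bool"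
  for P A L where
  "\<lbrakk> c \<in> P; variant c (Clause H B); vars_clause (Clause H B) \<inter> vars_query (Pos A # L) = {};
     mgu \<theta> A H \<rbrakk> \<Longrightarrow> resolvent P A L (subst_query \<theta> (B @ L))"

datatype branch_status = Success | Failure | Floundering

text \<open>
  \<open>finite_ldnf_tree P Q S\<close>: the construction of the LDNF-tree for \<open>P \<union> {Q}\<close>, including all nested
  subsidiary trees, terminates, and \<open>S\<close> is the (always non-empty) set of statuses of its branches.
  The tree is finitely failed iff \<open>S = {Failure}\<close>.

  A node has one child for every renaming of a clause and every mgu. For a finite program only
  finitely many of these are distinct up to renaming of variables, so finiteness of the tree is
  expressed as the absence of infinite branches, that is, by the least fixpoint.

  If a subsidiary tree is finite, has no successful branch and is not finitely failed (because some
  branch flounders), then the parent node has no resolvent and is neither successful nor failed.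
\<close>

inductive finite_ldnf_tree ::
  "('f, 'p) clause set \<Rightarrow> ('f, 'p) query \<Rightarrow> branch_status set \<Rightarrow> bool"
  for P where
  empty: "finite_ldnf_tree P [] {Success}"
| pos_fail: "\<nexists>Q. resolvent P A L Q \<Longrightarrow> finite_ldnf_tree P (Pos A # L) {Failure}"
| pos: "\<lbrakk> \<exists>Q. resolvent P A L Q; \<forall>Q. resolvent P A L Q \<longrightarrow> finite_ldnf_tree P Q (S Q) \<rbrakk> \<Longrightarrow>
    finite_ldnf_tree P (Pos A # L) (\<Union>Q\<in>{Q. resolvent P A L Q}. S Q)"
| neg_resolve: "\<lbrakk> ground_atom A; finite_ldnf_tree P [Pos A] {Failure}; finite_ldnf_tree P L S \<rbrakk> \<Longrightarrow>
    finite_ldnf_tree P (Neg A # L) S"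
| neg_fail: "\<lbrakk> ground_atom A; finite_ldnf_tree P [Pos A] S; Success \<in> S \<rbrakk> \<Longrightarrow>
    finite_ldnf_tree P (Neg A # L) {Failure}"
| neg_flounder: "\<lbrakk> ground_atom A; finite_ldnf_tree P [Pos A] S; Success \<notin> S; S \<noteq> {Failure} \<rbrakk> \<Longrightarrow>
    finite_ldnf_tree P (Neg A # L) {Floundering}"
| neg_nonground: "\<not> ground_atom A \<Longrightarrow> finite_ldnf_tree P (Neg A # L) {Floundering}"

inductive ldnf_step :: "('f, 'p) clause set \<Rightarrow> ('f, 'p) query \<Rightarrow> ('f, 'p) query \<Rightarrow> bool"
  for P where
  resolve: "resolvent P A L Q \<Longrightarrow> ldnf_step P (Pos A # L) Q"
| resolve_neg: "\<lbrakk> ground_atom A; finite_ldnf_tree P [Pos A] {Failure} \<rbrakk> \<Longrightarrow>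
    ldnf_step P (Neg A # L) L"
| subsidiary: "ground_atom A \<Longrightarrow> ldnf_step P (Neg A # L) [Pos A]"

definition ldnf_descendant :: "('f, 'p) clause set \<Rightarrow> ('f, 'p) query \<Rightarrow> ('f, 'p) query \<Rightarrow> bool" where
  "ldnf_descendant P Q Q' \<longleftrightarrow> (ldnf_step P)\<^sup>*\<^sup>* Q Q'"

definition all_ldnf_derivations_finite :: "('f, 'p) clause set \<Rightarrow> ('f, 'p) query \<Rightarrow> bool" where
  "all_ldnf_derivations_finite P Q \<longleftrightarrow>
     (\<nexists>q :: nat \<Rightarrow> ('f, 'p) query. q 0 = Q \<and> (\<forall>k. ldnf_step P (q k) (q (Suc k))))"

definition closed_class ::
  "('f, 'p) lang \<Rightarrow> ('f, 'p) clause set \<Rightarrow> ('f, 'p) query set \<Rightarrow> bool" where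
  "closed_class \<Sigma> P C \<longleftrightarrow>
     (\<forall>Q\<in>C. wf_query \<Sigma> Q) \<and>
     (\<forall>Q\<in>C. \<forall>i. 1 \<le> i \<and> i \<le> length Q \<longrightarrow> take i Q \<in> C) \<and>
     (\<forall>Q\<in>C. \<forall>Q'. ldnf_descendant P Q Q' \<longrightarrow> Q' \<in> C)"


section \<open>Interpretations and complete models\<close>

text \<open>
  Interpretations are arbitrary, not only Herbrand ones; the domain is the whole type \<open>'d\<close> and equality is
  identity. Only the values on argument lists of the right length are relevant.
\<close>

record ('f, 'p, 'd) interp =
  fun_interp :: "'f \<Rightarrow> 'd list \<Rightarrow> 'd"
  pred_interp :: "'p \<Rightarrow> 'd list \<Rightarrow> bool"

fun eval :: "('f, 'p, 'd) interp \<Rightarrow> (nat \<Rightarrow> 'd) \<Rightarrow> 'f trm \<Rightarrow> 'd" where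
  "eval M \<alpha> (Var x) = \<alpha> x"
| "eval M \<alpha> (Fun f ts) = fun_interp M f (map (eval M \<alpha>) ts)"

definition sat_atom :: "('f, 'p, 'd) interp \<Rightarrow> (nat \<Rightarrow> 'd) \<Rightarrow> ('f, 'p) atom \<Rightarrow> bool" where
  "sat_atom M \<alpha> a \<longleftrightarrow> pred_interp M (pred a) (map (eval M \<alpha>) (args a))"

fun sat_lit :: "('f, 'p, 'd) interp \<Rightarrow> (nat \<Rightarrow> 'd) \<Rightarrow> ('f, 'p) literal \<Rightarrow> bool" where
  "sat_lit M \<alpha> (Pos a) \<longleftrightarrow> sat_atom M \<alpha> a"
| "sat_lit M \<alpha> (Neg a) \<longleftrightarrow> \<not> sat_atom M \<alpha> a"

definition sat_query :: "('f, 'p, 'd) interp \<Rightarrow> (nat \<Rightarrow> 'd) \<Rightarrow> ('f, 'p) query \<Rightarrow> bool" where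
  "sat_query M \<alpha> q \<longleftrightarrow> (\<forall>l\<in>set q. sat_lit M \<alpha> l)"

definition true_in :: "('f, 'p, 'd) interp \<Rightarrow> ('f, 'p) query \<Rightarrow> bool" where
  "true_in M q \<longleftrightarrow> (\<forall>\<alpha>. sat_query M \<alpha> q)"

definition model :: "('f, 'p, 'd) interp \<Rightarrow> ('f, 'p) clause set \<Rightarrow> bool" where
  "model M P \<longleftrightarrow> (\<forall>c\<in>P. \<forall>\<alpha>. sat_query M \<alpha> (body c) \<longrightarrow> sat_atom M \<alpha> (head c))"

definition refers_to :: "('f, 'p) clause set \<Rightarrow> 'p \<Rightarrow> 'p \<Rightarrow> bool" where
  "refers_to P p q \<longleftrightarrow> (\<exists>c\<in>P. pred (head c) = p \<and> q \<in> rel ` set (body c))"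

definition depends_on :: "('f, 'p) clause set \<Rightarrow> 'p \<Rightarrow> 'p \<Rightarrow> bool" where
  "depends_on P = (refers_to P)\<^sup>*\<^sup>*"

definition neg_rels :: "('f, 'p) clause set \<Rightarrow> 'p set" where
  "neg_rels P = {pred a |a c. c \<in> P \<and> Neg a \<in> set (body c)}"

definition neg_rels_star :: "('f, 'p) clause set \<Rightarrow> 'p set" where
  "neg_rels_star P = {q. \<exists>p\<in>neg_rels P. depends_on P p q}"

definition neg_part :: "('f, 'p) clause set \<Rightarrow> ('f, 'p) clause set" where
  "neg_part P = {c \<in> P. pred (head c) \<in> neg_rels_star P}"

definition free_equality :: "('f, 'p) lang \<Rightarrow> ('f, 'p, 'd) interp \<Rightarrow> bool" where
  "free_equality \<Sigma> M \<longleftrightarrow>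
     (\<forall>f g ds es. length ds = fun_arity \<Sigma> f \<longrightarrow> length es = fun_arity \<Sigma> g \<longrightarrow>
        fun_interp M f ds = fun_interp M g es \<longrightarrow> f = g \<and> ds = es) \<and>
     (\<forall>x t \<alpha>. wf_trm \<Sigma> t \<longrightarrow> x \<in> vars_trm t \<longrightarrow> t \<noteq> Var x \<longrightarrow> \<alpha> x \<noteq> eval M \<alpha> t)"

text \<open>
  \<open>M\<close> satisfies Clark's completion of \<open>P\<close> for the relations \<open>N\<close>: besides the free equality axioms,
  the completed definition of each \<open>p \<in> N\<close>, which is
  \<open>\<forall>\<^bold>x. p(\<^bold>x) \<longleftrightarrow> \<Or>i. \<exists>\<^bold>y\<^sub>i. \<^bold>x = \<^bold>t\<^sub>i \<and> body\<^sub>i\<close> over the clauses \<open>p(\<^bold>t\<^sub>i) \<leftarrow> body\<^sub>i\<close> of \<open>P\<close>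
  with variables \<open>\<^bold>y\<^sub>i\<close>. Without clauses for \<open>p\<close> it amounts to \<open>\<forall>\<^bold>x. \<not> p(\<^bold>x)\<close>.
\<close>

definition model_of_completion ::
  "('f, 'p) lang \<Rightarrow> ('f, 'p, 'd) interp \<Rightarrow> 'p set \<Rightarrow> ('f, 'p) clause set \<Rightarrow> bool" where
  "model_of_completion \<Sigma> M N P \<longleftrightarrow>
     free_equality \<Sigma> M \<and>
     (\<forall>p\<in>N. \<forall>ds. length ds = pred_arity \<Sigma> p \<longrightarrow>
        (pred_interp M p ds \<longleftrightarrow>
          (\<exists>c\<in>P. pred (head c) = p \<and>
            (\<exists>\<alpha>. ds = map (eval M \<alpha>) (args (head c)) \<and> sat_query M \<alpha> (body c)))))"

definition complete_model ::
  "('f, 'p) lang \<Rightarrow> ('f, 'p, 'd) interp \<Rightarrow> ('f, 'p) clause set \<Rightarrow> bool" where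
  "complete_model \<Sigma> M P \<longleftrightarrow>
     model M P \<and> model_of_completion \<Sigma> M (neg_rels_star P) (neg_part P)"


section \<open>Acceptability, boundedness and extension\<close>

text \<open>
  A level mapping for \<open>P\<close> is represented by a total function on atoms. The definitions below only use
  its values on ground well-formed atoms whose relation occurs in \<open>P\<close>, provided boundedness is
  only considered for atoms defined in \<open>P\<close>.
\<close>

definition acceptable ::
  "('f, 'p) lang \<Rightarrow> ('f, 'p) clause set \<Rightarrow> (('f, 'p) atom \<Rightarrow> nat) \<Rightarrow> ('f, 'p, 'd) interp \<Rightarrow> bool" where
  "acceptable \<Sigma> P lev M \<longleftrightarrow>
     (\<forall>A As B Bs. Clause A (As @ B # Bs) \<in> ground \<Sigma> P \<longrightarrow> true_in M As \<longrightarrow>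
        lev A > lev (atom_of B))"

definition bounded :: "('f, 'p) lang \<Rightarrow> (('f, 'p) atom \<Rightarrow> nat) \<Rightarrow> ('f, 'p) atom \<Rightarrow> bool" where
  "bounded \<Sigma> lev A \<longleftrightarrow> finite (lev ` ground_instances \<Sigma> A)"

definition defined_rels :: "('f, 'p) clause set \<Rightarrow> 'p set" where
  "defined_rels P = (\<lambda>c. pred (head c)) ` P"

definition occurring_rels :: "('f, 'p) clause set \<Rightarrow> 'p set" where
  "occurring_rels P = (\<Union>c\<in>P. insert (pred (head c)) (rel ` set (body c)))"

definition extends :: "('f, 'p) clause set \<Rightarrow> ('f, 'p) clause set \<Rightarrow> bool" where
  "extends P R \<longleftrightarrow> defined_rels P \<inter> occurring_rels R = {}"

end

theory Submission imports Defs begin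

text \<open>
  Termination of \<open>Q @ [l]\<close> reduces to termination of \<open>Q\<close> and of the instances of \<open>l\<close> that are reached
  when \<open>Q\<close> is solved; since the class is closed under prefixes and descendants, these instances are in
  the class. So only atoms matter. A query none of whose relations is defined in \<open>P\<close> behaves under \<open>P \<union> R\<close> as under \<open>R\<close>.
  For an atom defined in \<open>P\<close>, induct on a bound of the levels of its ground instances: by soundness of
  LDNF-resolution, a body literal is reached only after an instance of the preceding ones that is true in the
  complete model has been found, hence acceptability makes its level drop. Soundness of negation as failure
  rests on the free equality axioms, through unification: terms that can be equal in the model
  have an mgu through which the valuation factors.
\<close>

section \<open>Substitutions and evaluation\<close>

lemma subst_trm_Var [simp]: "subst_trm Var t = t"
  by (induction t) (auto intro: map_idI)

lemma subst_trm_subst_trm: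
  "subst_trm \<gamma> (subst_trm \<theta> t) = subst_trm (\<lambda>x. subst_trm \<gamma> (\<theta> x)) t"
  by (induction t) auto

lemma subst_atom_subst_atom:
  "subst_atom \<gamma> (subst_atom \<theta> a) = subst_atom (\<lambda>x. subst_trm \<gamma> (\<theta> x)) a"
  by (simp add: subst_atom_def subst_trm_subst_trm)

lemma subst_lit_subst_lit:
  "subst_lit \<gamma> (subst_lit \<theta> l) = subst_lit (\<lambda>x. subst_trm \<gamma> (\<theta> x)) l"
  by (cases l) (simp_all add: subst_atom_subst_atom)

lemma subst_query_subst_query:
  "subst_query \<gamma> (subst_query \<theta> q) = subst_query (\<lambda>x. subst_trm \<gamma> (\<theta> x)) q"
  by (simp add: subst_query_def subst_lit_subst_lit)

lemma subst_clause_subst_clause: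
  "subst_clause \<gamma> (subst_clause \<theta> c) = subst_clause (\<lambda>x. subst_trm \<gamma> (\<theta> x)) c"
  by (simp add: subst_clause_def subst_atom_subst_atom subst_query_subst_query)

lemma subst_query_simps [simp]:
  "subst_query \<sigma> [] = []"
  "subst_query \<sigma> (l # q) = subst_lit \<sigma> l # subst_query \<sigma> q"
  "subst_query \<sigma> (q @ q') = subst_query \<sigma> q @ subst_query \<sigma> q'"
  by (simp_all add: subst_query_def)

lemma atom_of_subst_lit [simp]: "atom_of (subst_lit \<sigma> l) = subst_atom \<sigma> (atom_of l)"
  by (cases l) simp_all

lemma pred_subst_atom [simp]: "pred (subst_atom \<sigma> a) = pred a"
  by (simp add: subst_atom_def)

lemma rel_subst_query [simp]: "rel ` set (subst_query \<sigma> q) = rel ` set q"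
  by (simp add: subst_query_def image_image)

lemma Neg_in_subst_query: "Neg a \<in> set (subst_query \<sigma> q) \<Longrightarrow> \<exists>b. Neg b \<in> set q \<and> pred b = pred a"
  unfolding subst_query_def
proof clarsimp
  fix l assume "l \<in> set q" "Neg a = subst_lit \<sigma> l"
  then show "\<exists>b. Neg b \<in> set q \<and> pred b = pred a" by (cases l rule: literal.exhaust) auto
qed

lemma finite_vars_trm [simp]: "finite (vars_trm t)"
  by (induction t) auto

lemma finite_vars_query [simp]: "finite (vars_query q)"
  by (simp add: vars_query_def vars_atom_def)

lemma finite_vars_clause [simp]: "finite (vars_clause c)"
  by (simp add: vars_clause_def vars_atom_def)

lemma vars_query_simps [simp]:
  "vars_query [] = {}"
  "vars_query (l # q) = vars_atom (atom_of l) \<union> vars_query q"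
  "vars_query (q @ q') = vars_query q \<union> vars_query q'"
  by (auto simp: vars_query_def)

lemma wf_query_simps [simp]:
  "wf_query \<Sigma> []"
  "wf_query \<Sigma> (l # q) \<longleftrightarrow> wf_atom \<Sigma> (atom_of l) \<and> wf_query \<Sigma> q"
  "wf_query \<Sigma> (q @ q') \<longleftrightarrow> wf_query \<Sigma> q \<and> wf_query \<Sigma> q'"
  by (auto simp: wf_query_def)

lemma vars_subst_trm: "vars_trm (subst_trm \<sigma> t) = (\<Union>x\<in>vars_trm t. vars_trm (\<sigma> x))"
  by (induction t) auto

lemma vars_subst_atom: "vars_atom (subst_atom \<sigma> a) = (\<Union>x\<in>vars_atom a. vars_trm (\<sigma> x))"
  by (simp add: vars_atom_def subst_atom_def vars_subst_trm)

lemma vars_subst_query: "vars_query (subst_query \<sigma> q) = (\<Union>x\<in>vars_query q. vars_trm (\<sigma> x))"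
  by (simp add: vars_query_def subst_query_def vars_subst_atom)

lemma vars_subst_clause: "vars_clause (subst_clause \<sigma> c) = (\<Union>x\<in>vars_clause c. vars_trm (\<sigma> x))"
  by (simp add: vars_clause_def subst_clause_def vars_subst_atom vars_subst_query)

lemma wf_subst_trm: "wf_trm \<Sigma> t \<Longrightarrow> (\<And>x. wf_trm \<Sigma> (\<sigma> x)) \<Longrightarrow> wf_trm \<Sigma> (subst_trm \<sigma> t)"
  by (induction t) auto

lemma wf_subst_trmD: "wf_trm \<Sigma> (subst_trm \<sigma> t) \<Longrightarrow> wf_trm \<Sigma> t"
  by (induction t) auto

lemma wf_subst_atom: "wf_atom \<Sigma> a \<Longrightarrow> (\<And>x. wf_trm \<Sigma> (\<sigma> x)) \<Longrightarrow> wf_atom \<Sigma> (subst_atom \<sigma> a)"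
  by (simp add: wf_atom_def subst_atom_def wf_subst_trm)

lemma wf_subst_query: "wf_query \<Sigma> q \<Longrightarrow> (\<And>x. wf_trm \<Sigma> (\<sigma> x)) \<Longrightarrow> wf_query \<Sigma> (subst_query \<sigma> q)"
  by (simp add: wf_query_def subst_query_def wf_subst_atom)

lemma wf_subst_clause: "wf_clause \<Sigma> c \<Longrightarrow> (\<And>x. wf_trm \<Sigma> (\<sigma> x)) \<Longrightarrow> wf_clause \<Sigma> (subst_clause \<sigma> c)"
  by (simp add: wf_clause_def subst_clause_def wf_subst_atom wf_subst_query)

lemma subst_trm_cong: "(\<And>x. x \<in> vars_trm t \<Longrightarrow> \<sigma> x = \<tau> x) \<Longrightarrow> subst_trm \<sigma> t = subst_trm \<tau> t"
  by (induction t) auto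

lemma subst_ground_atom: "ground_atom a \<Longrightarrow> subst_atom \<sigma> a = a"
proof -
  assume "ground_atom a"
  then have "subst_trm \<sigma> t = t" if "t \<in> set (args a)" for t
    using that subst_trm_cong[of t \<sigma> Var] by (auto simp: ground_atom_def vars_atom_def)
  then show ?thesis by (cases a) (simp add: subst_atom_def map_idI)
qed

section \<open>Evaluation and satisfaction under substitution\<close>

lemma eval_subst: "eval M \<alpha> (subst_trm \<sigma> t) = eval M (\<lambda>x. eval M \<alpha> (\<sigma> x)) t"
  by (induction t) (auto intro!: arg_cong[where f = "fun_interp M _"])

lemma sat_subst_atom: "sat_atom M \<alpha> (subst_atom \<sigma> a) \<longleftrightarrow> sat_atom M (\<lambda>x. eval M \<alpha> (\<sigma> x)) a"
  by (simp add: sat_atom_def subst_atom_def eval_subst comp_def)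

lemma sat_subst_query: "sat_query M \<alpha> (subst_query \<sigma> q) \<longleftrightarrow> sat_query M (\<lambda>x. eval M \<alpha> (\<sigma> x)) q"
proof -
  have "sat_lit M \<alpha> (subst_lit \<sigma> l) \<longleftrightarrow> sat_lit M (\<lambda>x. eval M \<alpha> (\<sigma> x)) l" for l
    by (cases l) (simp_all add: sat_subst_atom)
  then show ?thesis by (simp add: sat_query_def subst_query_def)
qed

lemma sat_query_simps [simp]:
  "sat_query M \<alpha> []"
  "sat_query M \<alpha> (l # q) \<longleftrightarrow> sat_lit M \<alpha> l \<and> sat_query M \<alpha> q"
  "sat_query M \<alpha> (q @ q') \<longleftrightarrow> sat_query M \<alpha> q \<and> sat_query M \<alpha> q'"
  by (auto simp: sat_query_def)

lemma eval_cong: "(\<And>x. x \<in> vars_trm t \<Longrightarrow> \<alpha> x = \<beta> x) \<Longrightarrow> eval M \<alpha> t = eval M \<beta> t"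
proof (induction t)
  case (Fun f ts)
  then have "map (eval M \<alpha>) ts = map (eval M \<beta>) ts" by auto
  then show ?case by (simp only: eval.simps)
qed simp

lemma map_eval_cong:
  "(\<And>x. x \<in> vars_atom a \<Longrightarrow> \<alpha> x = \<beta> x) \<Longrightarrow> map (eval M \<alpha>) (args a) = map (eval M \<beta>) (args a)"
  by (auto simp: vars_atom_def intro!: eval_cong)

lemma sat_atom_cong:
  "(\<And>x. x \<in> vars_atom a \<Longrightarrow> \<alpha> x = \<beta> x) \<Longrightarrow> sat_atom M \<alpha> a \<longleftrightarrow> sat_atom M \<beta> a"
  unfolding sat_atom_def by (subst map_eval_cong) auto

lemma sat_query_cong:
  assumes "\<And>x. x \<in> vars_query q \<Longrightarrow> \<alpha> x = \<beta> x"
  shows "sat_query M \<alpha> q \<longleftrightarrow> sat_query M \<beta> q"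
proof -
  have "sat_lit M \<alpha> l \<longleftrightarrow> sat_lit M \<beta> l" if "l \<in> set q" for l
  proof -
    have "sat_atom M \<alpha> (atom_of l) \<longleftrightarrow> sat_atom M \<beta> (atom_of l)"
      using that assms by (intro sat_atom_cong) (auto simp: vars_query_def)
    then show ?thesis by (cases l) simp_all
  qed
  then show ?thesis by (simp add: sat_query_def)
qed


section \<open>Unification in structures with free equality\<close>

definition unifies :: "'f subst \<Rightarrow> ('f trm \<times> 'f trm) list \<Rightarrow> bool" where
  "unifies \<sigma> E \<longleftrightarrow> (\<forall>(s, t)\<in>set E. subst_trm \<sigma> s = subst_trm \<sigma> t)"

definition solves :: "('f, 'p, 'd) interp \<Rightarrow> (nat \<Rightarrow> 'd) \<Rightarrow> ('f trm \<times> 'f trm) list \<Rightarrow> bool" where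
  "solves M \<alpha> E \<longleftrightarrow> (\<forall>(s, t)\<in>set E. eval M \<alpha> s = eval M \<alpha> t)"

definition vars_eqs :: "('f trm \<times> 'f trm) list \<Rightarrow> nat set" where
  "vars_eqs E = (\<Union>(s, t)\<in>set E. vars_trm s \<union> vars_trm t)"

lemma unifies_simps [simp]:
  "unifies \<sigma> []"
  "unifies \<sigma> ((s, t) # E) \<longleftrightarrow> subst_trm \<sigma> s = subst_trm \<sigma> t \<and> unifies \<sigma> E"
  "unifies \<sigma> (E @ E') \<longleftrightarrow> unifies \<sigma> E \<and> unifies \<sigma> E'"
  by (auto simp: unifies_def)

lemma solves_simps [simp]:
  "solves M \<alpha> []"
  "solves M \<alpha> ((s, t) # E) \<longleftrightarrow> eval M \<alpha> s = eval M \<alpha> t \<and> solves M \<alpha> E"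
  "solves M \<alpha> (E @ E') \<longleftrightarrow> solves M \<alpha> E \<and> solves M \<alpha> E'"
  by (auto simp: solves_def)

lemma vars_eqs_simps [simp]:
  "vars_eqs [] = {}"
  "vars_eqs ((s, t) # E) = vars_trm s \<union> vars_trm t \<union> vars_eqs E"
  "vars_eqs (E @ E') = vars_eqs E \<union> vars_eqs E'"
  by (auto simp: vars_eqs_def)

lemma finite_vars_eqs [simp]: "finite (vars_eqs E)"
  by (auto simp: vars_eqs_def)

lemma unifies_zip:
  "length ts = length us \<Longrightarrow> unifies \<sigma> (zip ts us) \<longleftrightarrow> map (subst_trm \<sigma>) ts = map (subst_trm \<sigma>) us"
  by (induction ts us rule: list_induct2) auto

lemma solves_zip:
  "length ts = length us \<Longrightarrow> solves M \<alpha> (zip ts us) \<longleftrightarrow> map (eval M \<alpha>) ts = map (eval M \<alpha>) us"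
  by (induction ts us rule: list_induct2) auto

lemma vars_eqs_zip:
  "length ts = length us \<Longrightarrow>
    vars_eqs (zip ts us) = (\<Union>t\<in>set ts. vars_trm t) \<union> (\<Union>u\<in>set us. vars_trm u)"
  by (induction ts us rule: list_induct2) auto

abbreviation subst_eqs :: "'f subst \<Rightarrow> ('f trm \<times> 'f trm) list \<Rightarrow> ('f trm \<times> 'f trm) list" where
  "subst_eqs \<sigma> E \<equiv> map (map_prod (subst_trm \<sigma>) (subst_trm \<sigma>)) E"

lemma unifies_subst_eqs: "unifies \<theta> (subst_eqs \<sigma> E) \<longleftrightarrow> unifies (\<lambda>x. subst_trm \<theta> (\<sigma> x)) E"
  by (induction E) (auto simp: subst_trm_subst_trm)

lemma solves_subst_eqs: "solves M \<alpha> (subst_eqs \<sigma> E) \<longleftrightarrow> solves M (\<lambda>x. eval M \<alpha> (\<sigma> x)) E"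
  by (induction E) (auto simp: eval_subst)

lemma vars_subst_eqs: "vars_eqs (subst_eqs \<sigma> E) = (\<Union>x\<in>vars_eqs E. vars_trm (\<sigma> x))"
  by (induction E) (auto simp: vars_subst_trm)

text \<open>Secondary termination measure of unification. Counting left-hand sides only makes it
  drop when an equation with a variable on the right is turned around.\<close>

abbreviation left_size :: "('f trm \<times> 'f trm) list \<Rightarrow> nat" where
  "left_size E \<equiv> size_list (\<lambda>p. size (fst p)) E"

lemma left_size_zip: "length ts = length us \<Longrightarrow> left_size (zip ts us) = size_list size ts"
  by (induction ts us rule: list_induct2) auto

lemma left_size_append: "left_size (E @ E') = left_size E + left_size E'"
  by (induction E) auto

lemma free_equality_Fun:
  assumes "free_equality \<Sigma> M" "wf_trm \<Sigma> (Fun f ts)" "wf_trm \<Sigma> (Fun g us)"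
    and "eval M \<alpha> (Fun f ts) = eval M \<alpha> (Fun g us)"
  shows "f = g \<and> map (eval M \<alpha>) ts = map (eval M \<alpha>) us"
proof -
  have "length (map (eval M \<alpha>) ts) = fun_arity \<Sigma> f" "length (map (eval M \<alpha>) us) = fun_arity \<Sigma> g"
    using assms(2,3) by simp_all
  then show ?thesis
    using assms(1,4) unfolding free_equality_def eval.simps by blast
qed

lemma free_equality_occurs:
  "free_equality \<Sigma> M \<Longrightarrow> wf_trm \<Sigma> t \<Longrightarrow> x \<in> vars_trm t \<Longrightarrow> t \<noteq> Var x \<Longrightarrow> \<alpha> x \<noteq> eval M \<alpha> t"
  unfolding free_equality_def by blast

text \<open>Rule-based unification, run along a solution \<open>\<alpha>\<close> in a structure with
  free equality. Each rule keeps \<open>\<alpha>\<close> a solution, and the axioms exclude symbol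
  clash and occurs-check failure, so the run cannot get stuck. The number of variables decreases
  lexicographically with \<open>left_size\<close>. The result satisfies a strong form of generality:
  every unifier, and likewise \<open>\<alpha>\<close>, absorbs \<open>\<theta>\<close>.\<close>

lemma exists_mgu_eqs:
  fixes M :: "('f, 'p, 'd) interp"
  assumes free: "free_equality \<Sigma> M"
    and "\<forall>(s, t)\<in>set E. wf_trm \<Sigma> s \<and> wf_trm \<Sigma> t"
    and "solves M \<alpha> E"
  shows "\<exists>\<theta>. (\<forall>x. wf_trm \<Sigma> (\<theta> x)) \<and> unifies \<theta> E \<and>
    (\<forall>\<sigma>. unifies \<sigma> E \<longrightarrow> (\<forall>x. subst_trm \<sigma> (\<theta> x) = \<sigma> x)) \<and> (\<forall>x. eval M \<alpha> (\<theta> x) = \<alpha> x)"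
  using assms(2,3)
proof (induction E rule: wf_induct_rule[OF wf_measures[of "[\<lambda>E. card (vars_eqs E), left_size]"]])
  case (1 E)
  let ?goal = "\<lambda>E. \<exists>\<theta>. (\<forall>x. wf_trm \<Sigma> (\<theta> x)) \<and> unifies \<theta> E \<and>
    (\<forall>\<sigma>. unifies \<sigma> E \<longrightarrow> (\<forall>x. subst_trm \<sigma> (\<theta> x) = \<sigma> x)) \<and> (\<forall>x. eval M \<alpha> (\<theta> x) = \<alpha> x)"
  have IH: "?goal E'" if "card (vars_eqs E') < card (vars_eqs E) \<or>
      card (vars_eqs E') \<le> card (vars_eqs E) \<and> left_size E' < left_size E"
    "\<forall>(s, t)\<in>set E'. wf_trm \<Sigma> s \<and> wf_trm \<Sigma> t" "solves M \<alpha> E'" for E'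
    using "1.IH" that by (auto simp: le_less)
  show ?case
  proof (cases E)
    case Nil
    then show ?thesis by (intro exI[of _ Var]) auto
  next
    case (Cons p F)
    obtain s t where p: "p = (s, t)" by fastforce
    have wf: "wf_trm \<Sigma> s" "wf_trm \<Sigma> t" "\<forall>(s, t)\<in>set F. wf_trm \<Sigma> s \<and> wf_trm \<Sigma> t"
      and sol: "eval M \<alpha> s = eval M \<alpha> t" "solves M \<alpha> F"
      using "1.prems" Cons p by auto
    show ?thesis
    proof (cases s)
      case s: (Var x)
      show ?thesis
      proof (cases "t = Var x")
        case True
        have "?goal F"
          by (rule IH) (use wf sol Cons p in \<open>auto intro!: card_mono\<close>)
        then show ?thesis using True s Cons p by auto
      next
        case False
        \<comment> \<open>The occurs check succeeds: otherwise \<open>\<alpha> x\<close> would equal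
          the value of a proper superterm of \<open>x\<close>.\<close>
        have x: "x \<notin> vars_trm t"
          using free_equality_occurs[OF free wf(2) _ False, of \<alpha>] sol(1) s by auto
        let ?\<delta> = "Var(x := t)"
        have "subst_trm ?\<delta> t = subst_trm Var t"
          by (rule subst_trm_cong) (use x in auto)
        then have \<delta>: "subst_trm ?\<delta> t = t" by simp
        have wf\<delta>: "wf_trm \<Sigma> (?\<delta> y)" for y using wf(2) by simp
        have "?goal (subst_eqs ?\<delta> F)"
        proof (rule IH)
          have "vars_eqs (subst_eqs ?\<delta> F) \<subset> vars_eqs E"
            using x s Cons p by (auto simp: vars_subst_eqs split: if_splits)
          then show "card (vars_eqs (subst_eqs ?\<delta> F)) < card (vars_eqs E) \<or>
            card (vars_eqs (subst_eqs ?\<delta> F)) \<le> card (vars_eqs E) \<and>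
            left_size (subst_eqs ?\<delta> F) < left_size E"
            by (simp add: psubset_card_mono)
          show "\<forall>(s, t)\<in>set (subst_eqs ?\<delta> F). wf_trm \<Sigma> s \<and> wf_trm \<Sigma> t"
            using wf(3) wf\<delta> by (auto intro!: wf_subst_trm)
          \<comment> \<open>Since \<open>\<alpha>\<close> gives \<open>x\<close> and
            \<open>t\<close> the same value, replacing \<open>x\<close> by \<open>t\<close> leaves
            the valuation unchanged.\<close>
          have "(\<lambda>y. eval M \<alpha> (?\<delta> y)) = \<alpha>" using sol(1) s by auto
          then show "solves M \<alpha> (subst_eqs ?\<delta> F)"
            using sol(2) by (simp add: solves_subst_eqs)
        qed
        then obtain \<theta> where \<theta>: "\<And>x. wf_trm \<Sigma> (\<theta> x)" "unifies \<theta> (subst_eqs ?\<delta> F)"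
          "\<And>\<sigma> x. unifies \<sigma> (subst_eqs ?\<delta> F) \<Longrightarrow> subst_trm \<sigma> (\<theta> x) = \<sigma> x"
          "\<And>x. eval M \<alpha> (\<theta> x) = \<alpha> x" by blast
        let ?\<theta> = "\<lambda>y. subst_trm \<theta> (?\<delta> y)"
        show ?thesis
        proof (intro exI[of _ ?\<theta>] conjI allI impI)
          show "wf_trm \<Sigma> (?\<theta> y)" for y
            using \<theta>(1) wf(2) by (simp add: wf_subst_trm)
          have "subst_trm ?\<theta> t = subst_trm \<theta> (subst_trm ?\<delta> t)"
            by (simp only: subst_trm_subst_trm)
          then have "subst_trm ?\<theta> t = subst_trm \<theta> t" by (simp only: \<delta>)
          then show "unifies ?\<theta> E"
            using \<theta>(2) Cons p s by (simp add: unifies_subst_eqs)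
          show "subst_trm \<sigma> (?\<theta> y) = \<sigma> y" if "unifies \<sigma> E" for \<sigma> y
          proof -
            have "\<sigma> x = subst_trm \<sigma> t" "unifies \<sigma> F" using that Cons p s by auto
            \<comment> \<open>The same absorption on the syntactic side: a unifier of
              \<open>E\<close> already identifies \<open>x\<close> with \<open>t\<close>, hence it
              unifies the reduced system and the induction hypothesis applies to
              \<open>\<sigma>\<close> itself.\<close>
            moreover from this have eq: "(\<lambda>y. subst_trm \<sigma> (?\<delta> y)) = \<sigma>" by auto
            ultimately have "(\<lambda>y. subst_trm \<sigma> (\<theta> y)) = \<sigma>"
              using \<theta>(3)[of \<sigma>] by (simp only: unifies_subst_eqs)
            then have "subst_trm \<sigma> (?\<theta> y) = subst_trm \<sigma> (?\<delta> y)"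
              by (simp only: subst_trm_subst_trm)
            then show ?thesis using fun_cong[OF eq, of y] by (rule trans)
          qed
          have "(\<lambda>y. eval M \<alpha> (\<theta> y)) = \<alpha>" using \<theta>(4) by auto
          then show "eval M \<alpha> (?\<theta> y) = \<alpha> y" for y
            using sol(1) s by (simp add: eval_subst)
        qed
      qed
    next
      case s: (Fun f ts)
      show ?thesis
      proof (cases t)
        case t: (Var x)
        \<comment> \<open>Turning the equation around keeps the variables and shrinks the left-hand
          side from a compound term to a variable.\<close>
        have "?goal ((t, s) # F)"
          by (rule IH) (use wf sol Cons p s t in \<open>auto intro!: card_mono\<close>)
        then show ?thesis using Cons p by (auto simp: eq_commute)
      next
        case t: (Fun g us)
        have "f = g \<and> map (eval M \<alpha>) ts = map (eval M \<alpha>) us"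
          using free_equality_Fun[OF free] wf(1,2) sol(1) s t by blast
        then have fg: "f = g" and sol': "map (eval M \<alpha>) ts = map (eval M \<alpha>) us" by auto
        have len: "length ts = length us" using sol' by (rule map_eq_imp_length_eq)
        have "?goal (zip ts us @ F)"
        proof (rule IH)
          have "vars_eqs (zip ts us @ F) = vars_eqs E"
            using Cons p s t len by (auto simp: vars_eqs_zip)
          then show "card (vars_eqs (zip ts us @ F)) < card (vars_eqs E) \<or>
            card (vars_eqs (zip ts us @ F)) \<le> card (vars_eqs E) \<and>
            left_size (zip ts us @ F) < left_size E"
            using Cons p s by (simp only: left_size_append left_size_zip[OF len]) simp
          show "\<forall>(s, t)\<in>set (zip ts us @ F). wf_trm \<Sigma> s \<and> wf_trm \<Sigma> t"
            using wf s t by (auto dest: set_zip_leftD set_zip_rightD)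
          show "solves M \<alpha> (zip ts us @ F)"
            using sol(2) sol' len by (simp add: solves_zip)
        qed
        then show ?thesis using Cons p s t fg len by (simp add: unifies_zip)
      qed
    qed
  qed
qed

text \<open>The last conjunct is the point: the valuation under which the atoms coincide factors
  through the mgu, so whatever it satisfies remains satisfied after applying
  \<open>\<theta>\<close>.\<close>

lemma exists_mgu:
  assumes "free_equality \<Sigma> M" "wf_atom \<Sigma> a" "wf_atom \<Sigma> b"
    and "pred a = pred b" "map (eval M \<alpha>) (args a) = map (eval M \<alpha>) (args b)"
  shows "\<exists>\<theta>. mgu \<theta> a b \<and> (\<forall>x. wf_trm \<Sigma> (\<theta> x)) \<and> (\<forall>x. eval M \<alpha> (\<theta> x) = \<alpha> x)"
proof -
  have len: "length (args a) = length (args b)"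
    using assms(5) by (rule map_eq_imp_length_eq)
  have "unifier \<sigma> a b \<longleftrightarrow> unifies \<sigma> (zip (args a) (args b))" for \<sigma>
    using assms(4) len by (simp add: unifier_def subst_atom_def unifies_zip)
  moreover have "\<forall>(s, t)\<in>set (zip (args a) (args b)). wf_trm \<Sigma> s \<and> wf_trm \<Sigma> t"
    using assms(2,3) unfolding wf_atom_def by (auto dest: set_zip_leftD set_zip_rightD)
  moreover have "solves M \<alpha> (zip (args a) (args b))"
    using assms(5) len by (simp add: solves_zip)
  ultimately show ?thesis
    using exists_mgu_eqs[OF assms(1), of "zip (args a) (args b)" \<alpha>] unfolding mgu_def by metis
qed

section \<open>The term algebra, where valuations are substitutions, and well-formedness of
  mgus\<close>

definition trm_interp :: "('f, 'p, 'f trm) interp" where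
  "trm_interp = \<lparr>fun_interp = Fun, pred_interp = \<lambda>_ _. False\<rparr>"

lemma eval_trm_interp: "eval trm_interp \<sigma> t = subst_trm \<sigma> t"
  by (induction t) (auto simp: trm_interp_def)

lemma size_var_subst_le: "x \<in> vars_trm t \<Longrightarrow> size (\<sigma> x) \<le> size (subst_trm \<sigma> t)"
proof (induction t)
  case (Fun f ts)
  then obtain t where t: "t \<in> set ts" "x \<in> vars_trm t" by auto
  with Fun.IH have "size (\<sigma> x) \<le> size (subst_trm \<sigma> t)" by blast
  also have "\<dots> \<le> size_list size (map (subst_trm \<sigma>) ts)"
    using t by (intro size_list_estimation'[of "subst_trm \<sigma> t"]) auto
  finally show ?case by simp
qed simp

text \<open>Constructors are injective and distinct; the occurs axioms hold because a term is
  strictly larger than any instance of a variable sitting properly inside it.\<close>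

lemma free_equality_trm_interp: "free_equality \<Sigma> trm_interp"
  unfolding free_equality_def
proof (intro conjI allI impI)
  fix x and t :: "'a trm" and \<sigma> :: "'a subst"
  assume x: "x \<in> vars_trm t" and "t \<noteq> Var x"
  then obtain f ts where t: "t = Fun f ts" by (cases t) auto
  with x obtain u where u: "u \<in> set ts" "x \<in> vars_trm u" by auto
  have "size (\<sigma> x) \<le> size (subst_trm \<sigma> u)" using u(2) by (rule size_var_subst_le)
  also have "\<dots> \<le> size_list size (map (subst_trm \<sigma>) ts)"
    using u by (intro size_list_estimation'[of "subst_trm \<sigma> u"]) auto
  finally show "\<sigma> x \<noteq> eval trm_interp \<sigma> t" unfolding eval_trm_interp t by auto
qed (auto simp: trm_interp_def)

text \<open>The substitutions allowed in \<^const>\<open>mgu\<close> may be ill-formed, but a well-formed unifier factors through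
  every mgu, so that no mgu of well-formed atoms is ill-formed, not even on irrelevant variables.\<close>

lemma mgu_wf:
  assumes "mgu \<theta> a b" "wf_atom \<Sigma> a" "wf_atom \<Sigma> b"
  shows "wf_trm \<Sigma> (\<theta> x)"
proof -
  have eq: "subst_atom \<theta> a = subst_atom \<theta> b" using assms(1) by (simp add: mgu_def unifier_def)
  then have "pred a = pred b" by (metis pred_subst_atom)
  \<comment> \<open>Valuations of the term algebra are arbitrary, so \<open>\<theta>\<close> itself
    serves as the solution that guarantees a well-formed mgu.\<close>
  moreover have "map (eval trm_interp \<theta>) (args a) = map (eval trm_interp \<theta>) (args b)"
    using eq by (simp add: subst_atom_def eval_trm_interp[abs_def])
  ultimately obtain \<theta>' where "mgu \<theta>' a b" "\<And>x. wf_trm \<Sigma> (\<theta>' x)"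
    using exists_mgu[OF free_equality_trm_interp assms(2,3)] by blast
  then show ?thesis
    using assms(1) unfolding mgu_def by (metis wf_subst_trmD)
qed

lemma exists_renaming_apart:
  fixes V W :: "nat set"
  assumes "finite V" "finite W"
  shows "\<exists>\<rho> :: nat \<Rightarrow> nat. bij \<rho> \<and> \<rho> ` V \<inter> W = {}"
proof -
  obtain n where n: "\<forall>x\<in>V \<union> W. x < n"
    using assms finite_nat_set_iff_bounded[of "V \<union> W"] by auto
  \<comment> \<open>Variants are formed with permutations, so a mere shift does not do: this
    involution swaps the blocks below \<open>n\<close> and from \<open>n\<close> to below
    \<open>2 * n\<close>.\<close>
  let ?\<rho> = "\<lambda>x. if x < n then x + n else if x < 2 * n then x - n else x"
  have "bij ?\<rho>" by (rule o_bij[of ?\<rho>]) (auto simp: fun_eq_iff)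
  moreover have "?\<rho> ` V \<inter> W = {}" using n by auto
  ultimately show ?thesis by blast
qed


section \<open>LDNF-resolution\<close>

text \<open>The accessible part of the converse step relation, which gives induction along
  derivations, including descents into subsidiary trees.\<close>

abbreviation ldnf_terminates :: "('f, 'p) clause set \<Rightarrow> ('f, 'p) query \<Rightarrow> bool" where
  "ldnf_terminates P \<equiv> Wellfounded.accp (\<lambda>Q' Q. ldnf_step P Q Q')"

lemma all_ldnf_derivations_finite_iff:
  "all_ldnf_derivations_finite P Q \<longleftrightarrow> ldnf_terminates P Q"
proof
  assume fin: "all_ldnf_derivations_finite P Q"
  show "ldnf_terminates P Q"
  proof (rule ccontr)
    assume "\<not> ldnf_terminates P Q"
    moreover have "\<exists>Q''. \<not> ldnf_terminates P Q'' \<and> ldnf_step P Q' Q''"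
      if "\<not> ldnf_terminates P Q'" for Q'
      using that accp.accI[of "\<lambda>Q' Q. ldnf_step P Q Q'"] by blast
    \<comment> \<open>Dependent choice builds an infinite derivation out of nonterminating queries;
      the condition on \<open>k = 0\<close> fixes its start.\<close>
    ultimately have "\<exists>q. \<forall>k. (\<not> ldnf_terminates P (q k) \<and> (k = 0 \<longrightarrow> q k = Q)) \<and>
        ldnf_step P (q k) (q (Suc k))"
      by (intro dependent_nat_choice) auto
    then show False using fin unfolding all_ldnf_derivations_finite_def by blast
  qed
next
  assume "ldnf_terminates P Q"
  \<comment> \<open>The sequence is generalised so that the induction hypothesis applies to its
    tail.\<close>
  then have "\<And>q. q 0 = Q \<Longrightarrow> \<not> (\<forall>k. ldnf_step P (q k) (q (Suc k)))"
  proof (induction rule: accp.induct)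
    case (accI Q)
    show ?case
    proof
      assume "\<forall>k. ldnf_step P (q k) (q (Suc k))"
      moreover from this have "ldnf_step P Q (q (Suc 0))" using accI.prems by metis
      ultimately show False
        using accI.IH[of "q (Suc 0)" "\<lambda>k. q (Suc k)"] by blast
    qed
  qed
  then show "all_ldnf_derivations_finite P Q"
    unfolding all_ldnf_derivations_finite_def by blast
qed

lemma ldnf_terminates_Nil: "ldnf_terminates P []"
  by (rule accp.accI) (auto elim: ldnf_step.cases)

text \<open>Needed to conclude that every child of a finitely failed node is itself finitely failed,
  rather than having an empty status set.\<close>

lemma finite_ldnf_tree_nonempty: "finite_ldnf_tree P Q S \<Longrightarrow> S \<noteq> {}"
  by (induction rule: finite_ldnf_tree.induct) auto

lemma resolventE:
  assumes "resolvent P A L Q"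
  obtains c \<rho> \<theta> H B where "c \<in> P" "Clause H B = subst_clause (\<lambda>x. Var (\<rho> x)) c"
    "vars_clause (Clause H B) \<inter> vars_query (Pos A # L) = {}"
    "mgu \<theta> A H" "Q = subst_query \<theta> (B @ L)" "subst_atom \<theta> A = subst_atom \<theta> H"
    "pred (head c) = pred A" "rel ` set B = rel ` set (body c)"
    "\<And>a. Neg a \<in> set B \<Longrightarrow> \<exists>b. Neg b \<in> set (body c) \<and> pred b = pred a"
  using assms
proof cases
  case (1 c H B \<theta>)
  obtain \<rho> where \<rho>: "Clause H B = subst_clause (\<lambda>x. Var (\<rho> x)) c"
    using 1(3) unfolding variant_def by blast
  have eq: "subst_atom \<theta> A = subst_atom \<theta> H" using 1(5) by (simp add: mgu_def unifier_def)
  have HB: "H = subst_atom (\<lambda>x. Var (\<rho> x)) (head c)" "B = subst_query (\<lambda>x. Var (\<rho> x)) (body c)"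
    using \<rho> by (simp_all add: subst_clause_def)
  have "pred (head c) = pred A" using arg_cong[OF eq, of pred] HB by simp
  then show ?thesis
    using that[OF 1(2) \<rho> 1(4,5,1) eq] HB Neg_in_subst_query by (metis rel_subst_query)
qed

section \<open>Queries without relations defined in the extending program\<close>

definition undefined_in :: "('f, 'p) clause set \<Rightarrow> ('f, 'p) query \<Rightarrow> bool" where
  "undefined_in P Q \<longleftrightarrow> rel ` set Q \<inter> defined_rels P = {}"

text \<open>Unification preserves the relation symbol, so only clauses of \<open>R\<close> can match
  the selected atom.\<close>

lemma resolvent_undefined_in_iff:
  assumes "pred A \<notin> defined_rels P"
  shows "resolvent (P \<union> R) A L Q \<longleftrightarrow> resolvent R A L Q"
proof
  assume "resolvent (P \<union> R) A L Q"
  then show "resolvent R A L Q"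
  proof cases
    case (1 c H B \<theta>)
    obtain \<rho> where "Clause H B = subst_clause (\<lambda>x. Var (\<rho> x)) c"
      using 1(3) unfolding variant_def by blast
    then have "pred H = pred (head c)" by (simp add: subst_clause_def)
    moreover have "subst_atom \<theta> A = subst_atom \<theta> H" using 1(5) by (simp add: mgu_def unifier_def)
    ultimately have "pred (head c) = pred A" by (metis pred_subst_atom)
    then have "c \<in> R" using assms 1(2) unfolding defined_rels_def by (metis UnE imageI)
    then show ?thesis unfolding 1(1) using 1(3-5) by (rule resolvent.intros)
  qed
next
  assume "resolvent R A L Q"
  then show "resolvent (P \<union> R) A L Q"
    by cases (metis UnI2 resolvent.intros)
qed

lemma resolvent_undefined_in:
  assumes "extends P R" "resolvent R A L Q" "undefined_in P L"
  shows "undefined_in P Q"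
  using assms(2)
proof (rule resolventE)
  fix c \<theta> H B
  assume c: "c \<in> R" "Q = subst_query \<theta> (B @ L)" "rel ` set B = rel ` set (body c)"
  have "rel ` set Q = rel ` set (B @ L)" unfolding c(2) by (rule rel_subst_query)
  also have "\<dots> \<subseteq> occurring_rels R \<union> rel ` set L"
    using c(1,3) by (auto simp: occurring_rels_def image_Un)
  finally show ?thesis
    using assms(1,3) unfolding extends_def undefined_in_def by blast
qed

text \<open>A step past a negative literal presupposes a finitely failed subsidiary tree, so
  transferring steps from \<open>P \<union> R\<close> to \<open>R\<close> requires transferring
  trees as well.\<close>

lemma finite_ldnf_tree_undefined_in:
  assumes "extends P R" "finite_ldnf_tree (P \<union> R) Q S" "undefined_in P Q"
  shows "finite_ldnf_tree R Q S"
  using assms(2,3)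
proof (induction rule: finite_ldnf_tree.induct)
  case (pos_fail A L)
  then show ?case
    by (intro finite_ldnf_tree.pos_fail) (simp add: undefined_in_def resolvent_undefined_in_iff)
next
  case (pos A L S)
  have iff: "resolvent (P \<union> R) A L Q \<longleftrightarrow> resolvent R A L Q" for Q
    using pos.prems by (intro resolvent_undefined_in_iff) (simp add: undefined_in_def)
  have "undefined_in P L" using pos.prems by (simp add: undefined_in_def)
  then have "\<forall>Q. resolvent R A L Q \<longrightarrow> finite_ldnf_tree R Q (S Q)"
    using pos.IH iff resolvent_undefined_in[OF assms(1)] by blast
  then show ?case using finite_ldnf_tree.pos[of R A L S] pos.hyps iff by simp
qed (auto intro: finite_ldnf_tree.intros simp: undefined_in_def)

lemma ldnf_step_undefined_in:
  assumes "extends P R" "ldnf_step (P \<union> R) Q Q'" "undefined_in P Q"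
  shows "ldnf_step R Q Q' \<and> undefined_in P Q'"
  using assms(2)
proof cases
  case (resolve A L)
  then have "resolvent R A L Q'" "undefined_in P L"
    using assms(3) resolvent_undefined_in_iff[of A P R] by (auto simp: undefined_in_def)
  then show ?thesis
    using resolve resolvent_undefined_in[OF assms(1)] by (auto intro: ldnf_step.intros)
next
  case (resolve_neg A)
  then have "undefined_in P [Pos A]" using assms(3) by (auto simp: undefined_in_def)
  then show ?thesis using resolve_neg assms finite_ldnf_tree_undefined_in[OF assms(1)]
    by (auto intro: ldnf_step.intros simp: undefined_in_def)
next
  case (subsidiary A L)
  then show ?thesis using assms(3) by (auto intro: ldnf_step.intros simp: undefined_in_def)
qed

lemma ldnf_terminates_undefined_in:
  assumes "extends P R" "ldnf_terminates R Q" "undefined_in P Q"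
  shows "ldnf_terminates (P \<union> R) Q"
  using assms(2,3)
proof (induction rule: accp.induct)
  case (accI Q)
  show ?case
    using accI ldnf_step_undefined_in[OF assms(1)] by (blast intro: accp.accI)
qed


section \<open>Soundness of negation as failure\<close>

lemma neg_rels_star_body:
  assumes "c \<in> P" "pred (head c) \<in> neg_rels_star P" "q \<in> rel ` set (body c)"
  shows "q \<in> neg_rels_star P"
proof -
  have "refers_to P (pred (head c)) q" using assms(1,3) by (auto simp: refers_to_def)
  then show ?thesis
    using assms(2) unfolding neg_rels_star_def depends_on_def
    by (auto intro: rtranclp.rtrancl_into_rtrancl)
qed

lemma neg_rels_star_Neg: "c \<in> P \<Longrightarrow> Neg a \<in> set (body c) \<Longrightarrow> pred a \<in> neg_rels_star P"
  unfolding neg_rels_star_def depends_on_def neg_rels_def by blast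

lemma model_variant:
  assumes "model M P" "c \<in> P" "Clause H B = subst_clause \<sigma> c" "sat_query M \<alpha> B"
  shows "sat_atom M \<alpha> H"
proof -
  have "H = subst_atom \<sigma> (head c)" "B = subst_query \<sigma> (body c)"
    using assms(3) by (simp_all add: subst_clause_def)
  then show ?thesis
    using assms(1,2,4) by (simp add: model_def sat_subst_query sat_subst_atom)
qed

text \<open>Soundness of one resolution step: a true instance of the resolvent yields, after
  composition with the mgu, a true instance of the parent query.\<close>

lemma model_resolvent:
  assumes "model M P" "c \<in> P" "Clause H B = subst_clause \<rho> c" "subst_atom \<theta> A = subst_atom \<theta> H"
    and "true_in M (subst_query \<sigma> (subst_query \<theta> (B @ L)))"
  shows "true_in M (subst_query (\<lambda>x. subst_trm \<sigma> (\<theta> x)) (Pos A # L))"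
  unfolding true_in_def
proof
  fix \<alpha>
  let ?\<beta> = "\<lambda>x. eval M (\<lambda>x. eval M \<alpha> (\<sigma> x)) (\<theta> x)"
  have sat: "sat_query M ?\<beta> (B @ L)"
    using assms(5) by (simp add: true_in_def sat_subst_query)
  then have "sat_atom M ?\<beta> H"
    using model_variant[OF assms(1,2,3)] by simp
  then have "sat_atom M ?\<beta> A"
    using arg_cong[OF assms(4), of "sat_atom M (\<lambda>x. eval M \<alpha> (\<sigma> x))"]
    by (simp add: sat_subst_atom)
  then show "sat_query M \<alpha> (subst_query (\<lambda>x. subst_trm \<sigma> (\<theta> x)) (Pos A # L))"
    using sat unfolding sat_subst_query by (simp add: eval_subst)
qed

text \<open>The only-if half of the completed definition supplies a clause and a valuation
  \<open>\<beta>\<close> matching the true atom. After renaming the clause apart,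
  \<open>\<alpha>\<close> and \<open>\<beta>\<close> merge into one valuation that equates
  \<open>A\<close> with the clause head, and this valuation factors through an mgu. A satisfiable
  query thus has a satisfiable resolvent.\<close>

lemma resolvent_of_satisfied:
  assumes P: "program \<Sigma> P" and cm: "complete_model \<Sigma> M P"
    and wf: "wf_atom \<Sigma> A" and neg: "pred A \<in> neg_rels_star P"
    and sat: "sat_query M \<alpha> (Pos A # L)"
  shows "\<exists>Q \<beta>. resolvent P A L Q \<and> sat_query M \<beta> Q"
proof -
  have "length (map (eval M \<alpha>) (args A)) = pred_arity \<Sigma> (pred A)"
    using wf by (simp add: wf_atom_def)
  moreover have "pred_interp M (pred A) (map (eval M \<alpha>) (args A))"
    using sat by (simp add: sat_atom_def)
  ultimately obtain c \<beta> where c: "c \<in> neg_part P" "pred (head c) = pred A"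
    and \<beta>: "map (eval M \<alpha>) (args A) = map (eval M \<beta>) (args (head c))" "sat_query M \<beta> (body c)"
    using cm neg unfolding complete_model_def model_of_completion_def by blast
  have cP: "c \<in> P" using c(1) by (simp add: neg_part_def)
  then have wfc: "wf_clause \<Sigma> c" using P by (simp add: program_def)
  obtain \<rho> :: "nat \<Rightarrow> nat" where \<rho>: "bij \<rho>" "\<rho> ` vars_clause c \<inter> vars_query (Pos A # L) = {}"
    using exists_renaming_apart[of "vars_clause c" "vars_query (Pos A # L)"]
      finite_vars_clause finite_vars_query by blast
  let ?r = "\<lambda>x. Var (\<rho> x)"
  define H where "H = subst_atom ?r (head c)"
  define B where "B = subst_query ?r (body c)"
  have HB: "Clause H B = subst_clause ?r c" by (simp add: H_def B_def subst_clause_def)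
  have "vars_clause (Clause H B) = \<rho> ` vars_clause c"
    unfolding HB by (auto simp: vars_subst_clause)
  then have apart: "vars_clause (Clause H B) \<inter> vars_query (Pos A # L) = {}" using \<rho>(2) by simp
  have wfH: "wf_atom \<Sigma> H" using wfc by (simp add: H_def wf_clause_def wf_subst_atom)
  \<comment> \<open>The merged valuation: \<open>\<alpha>\<close> on the query,
    \<open>\<beta>\<close> pulled back along the renaming elsewhere. Disjointness of the variables
    makes it agree with both.\<close>
  define \<gamma> where "\<gamma> x = (if x \<in> vars_query (Pos A # L) then \<alpha> x else \<beta> (inv \<rho> x))" for x
  have \<gamma>\<alpha>: "\<gamma> x = \<alpha> x" if "x \<in> vars_query (Pos A # L)" for x using that by (simp add: \<gamma>_def)
  have \<gamma>\<beta>: "\<gamma> (\<rho> x) = \<beta> x" if "x \<in> vars_clause c" for x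
    using that \<rho> by (auto simp: \<gamma>_def bij_is_inj)
  have "map (eval M \<gamma>) (args H) = map (eval M \<beta>) (args (head c))"
  proof -
    have "map (eval M \<gamma>) (args H) = map (eval M (\<lambda>x. \<gamma> (\<rho> x))) (args (head c))"
      by (simp add: H_def subst_atom_def eval_subst)
    also have "\<dots> = map (eval M \<beta>) (args (head c))"
      by (rule map_eval_cong) (simp add: \<gamma>\<beta> vars_clause_def)
    finally show ?thesis .
  qed
  moreover have "map (eval M \<gamma>) (args A) = map (eval M \<alpha>) (args A)"
    by (rule map_eval_cong) (simp add: \<gamma>\<alpha>)
  ultimately have "map (eval M \<gamma>) (args A) = map (eval M \<gamma>) (args H)" using \<beta>(1) by simp
  moreover have "pred A = pred H" using c(2) by (simp add: H_def)
  moreover have "free_equality \<Sigma> M"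
    using cm by (simp add: complete_model_def model_of_completion_def)
  ultimately obtain \<theta> where \<theta>: "mgu \<theta> A H" "\<And>x. eval M \<gamma> (\<theta> x) = \<gamma> x"
    using exists_mgu wf wfH by blast
  have "variant c (Clause H B)" unfolding variant_def using \<rho>(1) HB by blast
  then have "resolvent P A L (subst_query \<theta> (B @ L))"
    using cP apart \<theta>(1) by (intro resolvent.intros)
  moreover have "sat_query M \<gamma> (subst_query \<theta> (B @ L))"
  proof -
    have "sat_query M \<gamma> B \<longleftrightarrow> sat_query M (\<lambda>x. \<gamma> (\<rho> x)) (body c)"
      by (simp add: B_def sat_subst_query)
    also have "\<dots> \<longleftrightarrow> sat_query M \<beta> (body c)"
      by (rule sat_query_cong) (simp add: \<gamma>\<beta> vars_clause_def)
    finally have "sat_query M \<gamma> B" using \<beta>(2) by simp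
    moreover have "sat_query M \<gamma> L"
      using sat sat_query_cong[of L \<gamma> \<alpha> M] \<gamma>\<alpha> by simp
    ultimately show ?thesis by (simp only: sat_subst_query \<theta>(2)) simp
  qed
  ultimately show ?thesis by blast
qed

lemma closed_class_step:
  "closed_class \<Sigma> P C \<Longrightarrow> Q \<in> C \<Longrightarrow> ldnf_step P Q Q' \<Longrightarrow> Q' \<in> C"
  unfolding closed_class_def ldnf_descendant_def by blast

lemma closed_class_wf: "closed_class \<Sigma> P C \<Longrightarrow> Q \<in> C \<Longrightarrow> wf_query \<Sigma> Q"
  unfolding closed_class_def by blast

lemma closed_class_prefix: "closed_class \<Sigma> P C \<Longrightarrow> Q @ Q' \<in> C \<Longrightarrow> Q \<noteq> [] \<Longrightarrow> Q \<in> C"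
  unfolding closed_class_def by (force dest!: bspec[of C _ "Q @ Q'"] spec[of _ "length Q"] simp: Suc_le_eq)

text \<open>Both claims are proved together because negation swaps them: \<open>Neg A\<close> is
  true when the tree of \<open>A\<close> fails and false when it succeeds. Restricting to
  \<open>neg_rels_star P\<close>, which is closed under passing to clause bodies, makes the
  completed definitions available; membership in \<open>C\<close> supplies well-formedness.\<close>

lemma finite_ldnf_tree_sound:
  assumes P: "program \<Sigma> P" and cm: "complete_model \<Sigma> M P" and C: "closed_class \<Sigma> P C"
    and "finite_ldnf_tree P Q S" "Q \<in> C" "rel ` set Q \<subseteq> neg_rels_star P"
  shows "(S = {Failure} \<longrightarrow> (\<forall>\<alpha>. \<not> sat_query M \<alpha> Q)) \<and>
    (Success \<in> S \<longrightarrow> (\<exists>\<sigma>. true_in M (subst_query \<sigma> Q)))"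
  using assms(4-6)
proof (induction rule: finite_ldnf_tree.induct)
  case empty
  then show ?case by (simp add: true_in_def)
next
  case (pos_fail A L)
  then have "wf_atom \<Sigma> A" using closed_class_wf[OF C] by fastforce
  then have "\<not> sat_query M \<alpha> (Pos A # L)" for \<alpha>
    using resolvent_of_satisfied[OF P cm, of A \<alpha> L] pos_fail by auto
  then show ?case by simp
next
  case (pos A L S)
  have wf: "wf_atom \<Sigma> A" using pos.prems(1) closed_class_wf[OF C] by fastforce
  have IH: "(S Q = {Failure} \<longrightarrow> (\<forall>\<alpha>. \<not> sat_query M \<alpha> Q)) \<and>
      (Success \<in> S Q \<longrightarrow> (\<exists>\<sigma>. true_in M (subst_query \<sigma> Q)))"
    and tree: "finite_ldnf_tree P Q (S Q)" if res: "resolvent P A L Q" for Q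
  proof -
    have "Q \<in> C"
      using res closed_class_step[OF C pos.prems(1)] by (blast intro: ldnf_step.intros)
    moreover have "rel ` set Q \<subseteq> neg_rels_star P"
      using res
    proof (rule resolventE)
      fix c \<theta> H B
      assume c: "c \<in> P" "Q = subst_query \<theta> (B @ L)" "pred (head c) = pred A"
        "rel ` set B = rel ` set (body c)"
      have "rel ` set Q = rel ` set (B @ L)" unfolding c(2) by (rule rel_subst_query)
      also have "\<dots> = rel ` set (body c) \<union> rel ` set L" using c(4) by (simp add: image_Un)
      finally show ?thesis
        using neg_rels_star_body[of c P] c(1,3) pos.prems(2) by auto
    qed
    ultimately show "(S Q = {Failure} \<longrightarrow> (\<forall>\<alpha>. \<not> sat_query M \<alpha> Q)) \<and>
      (Success \<in> S Q \<longrightarrow> (\<exists>\<sigma>. true_in M (subst_query \<sigma> Q)))"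
      using pos.IH res by blast
    show "finite_ldnf_tree P Q (S Q)" using pos.IH res by blast
  qed
  show ?case
  proof (intro conjI impI allI notI)
    fix \<alpha>
    assume fail: "(\<Union>Q\<in>{Q. resolvent P A L Q}. S Q) = {Failure}" and "sat_query M \<alpha> (Pos A # L)"
    then obtain Q \<beta> where Q: "resolvent P A L Q" "sat_query M \<beta> Q"
      using resolvent_of_satisfied[OF P cm wf, of \<alpha> L] pos.prems(2) by auto
    \<comment> \<open>The satisfiable resolvent inherits status \<open>{Failure}\<close>,
      contradicting the induction hypothesis.\<close>
    have "S Q \<subseteq> {Failure}" using fail Q(1) by blast
    then have "S Q = {Failure}"
      using finite_ldnf_tree_nonempty[OF tree[OF Q(1)]] by blast
    then show False using IH[OF Q(1)] Q(2) by blast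
  next
    assume "Success \<in> (\<Union>Q\<in>{Q. resolvent P A L Q}. S Q)"
    then obtain Q \<sigma> where Q: "resolvent P A L Q" "true_in M (subst_query \<sigma> Q)"
      using IH by blast
    show "\<exists>\<sigma>. true_in M (subst_query \<sigma> (Pos A # L))"
      using Q(1)
    proof (rule resolventE)
      fix c \<rho> \<theta> H B
      assume "c \<in> P" "Clause H B = subst_clause (\<lambda>x. Var (\<rho> x)) c"
        "Q = subst_query \<theta> (B @ L)" "subst_atom \<theta> A = subst_atom \<theta> H"
      then show ?thesis
        using model_resolvent[of M P c H B _ \<theta> A \<sigma> L] Q(2) cm
        unfolding complete_model_def by blast
    qed
  qed
next
  case (neg_resolve A L S)
  have "[Pos A] \<in> C" "L \<in> C"
    using neg_resolve closed_class_step[OF C neg_resolve.prems(1)]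
    by (blast intro: ldnf_step.intros)+
  then have A: "\<And>\<alpha>. \<not> sat_atom M \<alpha> A"
    and L: "(S = {Failure} \<longrightarrow> (\<forall>\<alpha>. \<not> sat_query M \<alpha> L)) \<and>
      (Success \<in> S \<longrightarrow> (\<exists>\<sigma>. true_in M (subst_query \<sigma> L)))"
    using neg_resolve by auto
  \<comment> \<open>As \<open>A\<close> is ground, the substitution that makes \<open>L\<close> true
    leaves \<open>Neg A\<close> unchanged.\<close>
  then show ?case
    using neg_resolve.hyps(1) by (auto simp: true_in_def subst_ground_atom)
next
  case (neg_fail A S L)
  have "[Pos A] \<in> C"
    using neg_fail closed_class_step[OF C neg_fail.prems(1)] by (blast intro: ldnf_step.intros)
  then show ?case
    using neg_fail by (auto simp: true_in_def subst_ground_atom)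
\<comment> \<open>The remaining cases have status \<open>{Floundering}\<close>, for which both
  claims are vacuous.\<close>
qed auto


section \<open>Termination\<close>

definition ground_subst :: "('f, 'p) lang \<Rightarrow> 'f subst \<Rightarrow> bool" where
  "ground_subst \<Sigma> \<gamma> \<longleftrightarrow> (\<forall>x. wf_trm \<Sigma> (\<gamma> x) \<and> vars_trm (\<gamma> x) = {})"

lemma ground_subst_exists:
  assumes "has_constant \<Sigma>"
  shows "\<exists>\<gamma>. ground_subst \<Sigma> \<gamma>"
proof -
  obtain c where "fun_arity \<Sigma> c = 0" using assms by (auto simp: has_constant_def)
  then have "ground_subst \<Sigma> (\<lambda>_. Fun c [])" by (simp add: ground_subst_def)
  then show ?thesis by blast
qed

lemma ground_subst_compose:
  "ground_subst \<Sigma> \<gamma> \<Longrightarrow> (\<And>x. wf_trm \<Sigma> (\<theta> x)) \<Longrightarrow> ground_subst \<Sigma> (\<lambda>x. subst_trm \<gamma> (\<theta> x))"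
  unfolding ground_subst_def by (auto simp: vars_subst_trm intro: wf_subst_trm)

lemma ground_subst_instance:
  "ground_subst \<Sigma> \<gamma> \<Longrightarrow> wf_atom \<Sigma> A \<Longrightarrow> subst_atom \<gamma> A \<in> ground_instances \<Sigma> A"
  unfolding ground_subst_def ground_instances_def ground_atom_def
  by (auto simp: vars_subst_atom intro: wf_subst_atom)

text \<open>
  A derivation of \<open>Q @ [l]\<close> follows one of \<open>Q\<close> until \<open>Q\<close> is solved and an instance of \<open>l\<close> is reached.
  The invariant \<open>J\<close> carries what is known about that instance, so that computed answer substitutions
  need not be mentioned.
\<close>

lemma ldnf_terminates_snoc:
  assumes C: "closed_class \<Sigma> P C"
    and resolve: "\<And>A L l c \<rho> \<theta> H B. \<lbrakk> Pos A # L @ [l] \<in> C; J (Pos A # L) l; c \<in> P;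
        Clause H B = subst_clause (\<lambda>x. Var (\<rho> x)) c; mgu \<theta> A H \<rbrakk> \<Longrightarrow>
        J (subst_query \<theta> (B @ L)) (subst_lit \<theta> l)"
    and neg: "\<And>A L l. \<lbrakk> Neg A # L @ [l] \<in> C; J (Neg A # L) l; ground_atom A;
        finite_ldnf_tree P [Pos A] {Failure} \<rbrakk> \<Longrightarrow> J L l"
    and last: "\<And>l. [l] \<in> C \<Longrightarrow> J [] l \<Longrightarrow> ldnf_terminates P [l]"
    and "ldnf_terminates P Q" "Q @ [l] \<in> C" "J Q l"
  shows "ldnf_terminates P (Q @ [l])"
  using assms(5-7)
proof (induction arbitrary: l rule: accp.induct)
  case (accI Q)
  show ?case
  proof (cases Q)
    case Nil
    then show ?thesis using accI.prems last by simp
  next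
    case (Cons k L)
    show ?thesis
    proof (rule accp.accI)
      fix Q' assume step: "ldnf_step P (Q @ [l]) Q'"
      then have "Q' \<in> C" using closed_class_step[OF C accI.prems(1)] by blast
      from step show "ldnf_terminates P Q'"
      proof cases
        case (resolve A L')
        then have k: "k = Pos A" "resolvent P A (L @ [l]) Q'" using Cons by auto
        from k(2) show ?thesis
        proof (cases)
          case (1 c H B \<theta>)
          \<comment> \<open>A clause renamed apart from the longer query is renamed apart from
            \<open>Q\<close> too, so the same clause and mgu give a step of
            \<open>Q\<close>.\<close>
          have "ldnf_step P Q (subst_query \<theta> (B @ L))"
            unfolding Cons k(1) using 1 by (intro ldnf_step.resolve resolvent.intros[of c P H B]) auto
          moreover have "subst_query \<theta> (B @ L) @ [subst_lit \<theta> l] \<in> C"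
            using \<open>Q' \<in> C\<close> 1(1) by simp
          moreover obtain \<rho> where "Clause H B = subst_clause (\<lambda>x. Var (\<rho> x)) c"
            using 1(3) unfolding variant_def by blast
          then have "J (subst_query \<theta> (B @ L)) (subst_lit \<theta> l)"
            using assms(2) 1 accI.prems Cons k(1) by (metis append_Cons)
          ultimately show ?thesis using accI.IH 1(1) by fastforce
        qed
      next
        case (resolve_neg A)
        then have k: "k = Neg A" "Q' = L @ [l]" using Cons by auto
        have "ldnf_step P Q L"
          unfolding Cons k(1) using resolve_neg by (intro ldnf_step.resolve_neg)
        moreover have "J L l" using neg resolve_neg accI.prems Cons k by auto
        ultimately show ?thesis using accI.IH \<open>Q' \<in> C\<close> k(2) by blast
      next
        case (subsidiary A L')
        \<comment> \<open>The root of a subsidiary tree depends only on the selected literal, so it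
          is already a successor of \<open>Q\<close>.\<close>
        then have "ldnf_step P Q Q'" using Cons by (auto intro: ldnf_step.intros)
        then show ?thesis by (rule accI.hyps)
      qed
    qed
  qed
qed

lemma ldnf_terminates_Neg:
  assumes "ground_atom A \<Longrightarrow> ldnf_terminates P [Pos A]"
  shows "ldnf_terminates P [Neg A]"
proof (rule accp.accI)
  fix Q assume "ldnf_step P [Neg A] Q"
  then show "ldnf_terminates P Q"
    using assms by cases (auto simp: ldnf_terminates_Nil)
qed

section \<open>Level bounds and the induction on levels\<close>

locale acceptable_extension =
  fixes \<Sigma> :: "('f, 'p) lang"
    and P R :: "('f, 'p) clause set"
    and M :: "('f, 'p, 'd) interp"
    and C :: "('f, 'p) query set"
    and lev :: "('f, 'p) atom \<Rightarrow> nat"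
  assumes const: "has_constant \<Sigma>"
    and P: "program \<Sigma> P" and R: "program \<Sigma> R"
    and ext: "extends P R"
    and cm: "complete_model \<Sigma> M (P \<union> R)"
    and C: "closed_class \<Sigma> (P \<union> R) C"
    and acc: "acceptable \<Sigma> P lev M"
    and termR: "Q \<in> C \<Longrightarrow> ldnf_terminates R Q"
    and bdd: "[Pos A] \<in> C \<Longrightarrow> pred A \<in> defined_rels P \<Longrightarrow> bounded \<Sigma> lev A"
begin

abbreviation "PR \<equiv> P \<union> R"

lemma program_PR: "program \<Sigma> PR"
  using P R by (auto simp: program_def)

definition bounded_by :: "nat \<Rightarrow> ('f, 'p) atom \<Rightarrow> bool" where
  "bounded_by n A \<longleftrightarrow> (\<forall>\<gamma>. ground_subst \<Sigma> \<gamma> \<longrightarrow> lev (subst_atom \<gamma> A) < n)"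

text \<open>The invariant carried along a derivation of \<open>Q\<close> followed by
  \<open>l\<close>. Levels are bounded only for instances that make \<open>Q\<close> true, as
  acceptability offers no more. The condition on negative literals keeps them within the scope of
  soundness of negation as failure.\<close>

definition bounded_after :: "nat \<Rightarrow> ('f, 'p) query \<Rightarrow> ('f, 'p) literal \<Rightarrow> bool" where
  "bounded_after n Q l \<longleftrightarrow> (\<forall>a. Neg a \<in> set Q \<longrightarrow> pred a \<in> neg_rels_star PR) \<and>
     (\<forall>\<gamma>. ground_subst \<Sigma> \<gamma> \<longrightarrow> true_in M (subst_query \<gamma> Q) \<longrightarrow>
        lev (subst_atom \<gamma> (atom_of l)) < n)"

lemma variant_mgu_wf:
  assumes "wf_atom \<Sigma> A" "c \<in> PR" "Clause H B = subst_clause (\<lambda>x. Var (\<rho> x)) c" "mgu \<theta> A H"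
  shows "wf_trm \<Sigma> (\<theta> x)"
proof -
  have "wf_clause \<Sigma> (Clause H B)"
    unfolding assms(3) using assms(2) program_PR by (auto simp: program_def intro: wf_subst_clause)
  then show ?thesis using mgu_wf[OF assms(4,1)] by (simp add: wf_clause_def)
qed

lemma variant_Neg:
  assumes "c \<in> PR" "Clause H B = subst_clause \<rho> c" "Neg a \<in> set B"
  shows "pred a \<in> neg_rels_star PR"
proof -
  have "B = subst_query \<rho> (body c)" using assms(2) by (simp add: subst_clause_def)
  then obtain b where "Neg b \<in> set (body c)" "pred b = pred a"
    using Neg_in_subst_query assms(3) by blast
  then show ?thesis using neg_rels_star_Neg assms(1) by metis
qed

text \<open>A ground instance of the resolvent by \<open>\<gamma>\<close> is traced back to the
  instance of the parent by \<open>\<theta>\<close> followed by \<open>\<gamma>\<close>, which is a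
  ground substitution because mgus are well-formed.\<close>

lemma bounded_after_resolve:
  assumes "Pos A # L @ [l] \<in> C" "bounded_after n (Pos A # L) l" "c \<in> PR"
    and HB: "Clause H B = subst_clause (\<lambda>x. Var (\<rho> x)) c" and mgu: "mgu \<theta> A H"
  shows "bounded_after n (subst_query \<theta> (B @ L)) (subst_lit \<theta> l)"
  unfolding bounded_after_def
proof (intro conjI allI impI)
  fix a assume "Neg a \<in> set (subst_query \<theta> (B @ L))"
  then obtain b where "Neg b \<in> set (B @ L)" and b: "pred b = pred a"
    using Neg_in_subst_query by blast
  then have "pred b \<in> neg_rels_star PR"
    using variant_Neg[OF assms(3) HB, of b] assms(2) by (auto simp: bounded_after_def)
  then show "pred a \<in> neg_rels_star PR" using b by simp
next
  fix \<gamma> assume \<gamma>: "ground_subst \<Sigma> \<gamma>" and true: "true_in M (subst_query \<gamma> (subst_query \<theta> (B @ L)))"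
  let ?\<gamma> = "\<lambda>x. subst_trm \<gamma> (\<theta> x)"
  have "wf_atom \<Sigma> A" using closed_class_wf[OF C assms(1)] by simp
  then have "ground_subst \<Sigma> ?\<gamma>"
    using ground_subst_compose[OF \<gamma>] variant_mgu_wf[OF _ assms(3) HB mgu] by blast
  moreover have "true_in M (subst_query ?\<gamma> (Pos A # L))"
    using model_resolvent[OF _ assms(3) HB _ true] cm mgu
    by (simp add: complete_model_def mgu_def unifier_def)
  ultimately show "lev (subst_atom \<gamma> (atom_of (subst_lit \<theta> l))) < n"
    using assms(2) by (simp add: bounded_after_def subst_atom_subst_atom)
qed

text \<open>Finite failure makes \<open>A\<close> false in \<open>M\<close>, so dropping
  \<open>Neg A\<close> does not change which instances of the query are true.\<close>

lemma bounded_after_neg: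
  assumes "Neg A # L @ [l] \<in> C" "bounded_after n (Neg A # L) l" "ground_atom A"
    and "finite_ldnf_tree PR [Pos A] {Failure}"
  shows "bounded_after n L l"
proof -
  have "[Pos A] \<in> C"
    using closed_class_step[OF C assms(1)] assms(3) by (blast intro: ldnf_step.intros)
  moreover have "rel ` set [Pos A] \<subseteq> neg_rels_star PR"
    using assms(2) by (simp add: bounded_after_def)
  ultimately have "\<not> sat_atom M \<alpha> A" for \<alpha>
    using finite_ldnf_tree_sound[OF program_PR cm C assms(4)] by simp
  then have "true_in M (subst_query \<gamma> (Neg A # L)) \<longleftrightarrow> true_in M (subst_query \<gamma> L)" for \<gamma>
    using assms(3) by (simp add: true_in_def subst_ground_atom)
  then show ?thesis using assms(2) by (simp add: bounded_after_def)
qed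

text \<open>Reduces literals to atoms defined in \<open>P\<close>: other atoms terminate because
  they do so under \<open>R\<close>, and a ground negative literal only adds its subsidiary tree.
  The parameter \<open>Q\<close> is a level bound inside the induction and trivial at the
  end.\<close>

lemma ldnf_terminates_literal:
  assumes atoms: "\<And>A. \<lbrakk> [Pos A] \<in> C; pred A \<in> defined_rels P; Q A \<rbrakk> \<Longrightarrow> ldnf_terminates PR [Pos A]"
    and "[l] \<in> C" "Q (atom_of l)"
  shows "ldnf_terminates PR [l]"
proof -
  have pos: "ldnf_terminates PR [Pos A]" if "[Pos A] \<in> C" "Q A" for A
  proof (cases "pred A \<in> defined_rels P")
    case True
    then show ?thesis using atoms that by blast
  next
    case False
    then show ?thesis
      using ldnf_terminates_undefined_in[OF ext termR[OF that(1)]] by (simp add: undefined_in_def)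
  qed
  show ?thesis
  proof (cases l)
    case (Pos A)
    then show ?thesis using pos assms by simp
  next
    case (Neg A)
    have "[Pos A] \<in> C" if "ground_atom A"
      using closed_class_step[OF C assms(2)] that Neg by (blast intro: ldnf_step.intros)
    then show ?thesis using pos assms(3) Neg ldnf_terminates_Neg[of A PR] by simp
  qed
qed

text \<open>Establishes the invariant when a clause of \<open>P\<close> is entered. Instances of the
  clause head coincide with instances of \<open>A\<close>, of level at most \<open>n\<close>, and
  acceptability puts the body literal strictly below.\<close>

lemma bounded_after_body:
  assumes "[Pos A] \<in> C" "bounded_by (Suc n) A" "c \<in> P"
    and HB: "Clause H (B @ l # B') = subst_clause (\<lambda>x. Var (\<rho> x)) c" and mgu: "mgu \<theta> A H"
  shows "bounded_after n (subst_query \<theta> B) (subst_lit \<theta> l)"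
  unfolding bounded_after_def
proof (intro conjI allI impI)
  have cPR: "c \<in> PR" using assms(3) by simp
  {
    fix a assume "Neg a \<in> set (subst_query \<theta> B)"
    then obtain b where "Neg b \<in> set B" and b: "pred b = pred a"
      using Neg_in_subst_query by blast
    then show "pred a \<in> neg_rels_star PR"
      using variant_Neg[OF cPR HB, of b] by simp
  next
    fix \<gamma> assume \<gamma>: "ground_subst \<Sigma> \<gamma>" and true: "true_in M (subst_query \<gamma> (subst_query \<theta> B))"
    let ?\<gamma> = "\<lambda>x. subst_trm \<gamma> (\<theta> x)"
    have "wf_atom \<Sigma> A" using closed_class_wf[OF C assms(1)] by simp
    then have g: "ground_subst \<Sigma> ?\<gamma>"
      using ground_subst_compose[OF \<gamma>] variant_mgu_wf[OF _ cPR HB mgu] by blast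
    have "wf_clause \<Sigma> c" using assms(3) P by (simp add: program_def)
    then have wf: "wf_clause \<Sigma> (Clause H (B @ l # B'))"
      unfolding HB by (auto intro: wf_subst_clause)
    have "subst_clause ?\<gamma> (Clause H (B @ l # B')) \<in> ground \<Sigma> P"
      unfolding ground_def
    proof (intro CollectI conjI)
      show "\<exists>c\<in>P. \<exists>\<sigma>. subst_clause ?\<gamma> (Clause H (B @ l # B')) = subst_clause \<sigma> c"
        unfolding HB subst_clause_subst_clause using assms(3) by blast
      show "wf_clause \<Sigma> (subst_clause ?\<gamma> (Clause H (B @ l # B')))"
        using wf g by (auto simp: ground_subst_def intro: wf_subst_clause)
      show "vars_clause (subst_clause ?\<gamma> (Clause H (B @ l # B'))) = {}"
        using g by (simp add: vars_subst_clause ground_subst_def)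
    qed
    then have "lev (subst_atom ?\<gamma> H) > lev (subst_atom ?\<gamma> (atom_of l))"
      using acc true unfolding acceptable_def
      by (simp add: subst_clause_def subst_query_subst_query) (metis atom_of_subst_lit)
    moreover have "subst_atom ?\<gamma> H = subst_atom ?\<gamma> A"
      using mgu by (simp add: mgu_def unifier_def flip: subst_atom_subst_atom)
    moreover have "lev (subst_atom ?\<gamma> A) < Suc n"
      using assms(2) g by (simp add: bounded_by_def)
    ultimately show "lev (subst_atom \<gamma> (atom_of (subst_lit \<theta> l))) < n"
      by (simp add: subst_atom_subst_atom)
  }
qed

lemma ldnf_terminates_bounded_atom:
  "[Pos A] \<in> C \<Longrightarrow> pred A \<in> defined_rels P \<Longrightarrow> bounded_by n A \<Longrightarrow> ldnf_terminates PR [Pos A]"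
proof (induction n arbitrary: A)
  case 0
  \<comment> \<open>No atom is bounded by 0: the constant of the language provides a ground
    substitution.\<close>
  then show ?case using ground_subst_exists[OF const] by (auto simp: bounded_by_def)
next
  case (Suc n)
  show ?case
  proof (rule accp.accI)
    fix Q assume step: "ldnf_step PR [Pos A] Q"
    have QC: "Q \<in> C" using closed_class_step[OF C Suc.prems(1) step] .
    from step have "resolvent PR A [] Q" by cases auto
    then show "ldnf_terminates PR Q"
    proof (rule resolventE)
      fix c \<rho> \<theta> H B
      assume c: "c \<in> PR" and HB: "Clause H B = subst_clause (\<lambda>x. Var (\<rho> x)) c"
        and mgu: "mgu \<theta> A H" and Q: "Q = subst_query \<theta> (B @ [])" and pred: "pred (head c) = pred A"
      \<comment> \<open>The head relation of \<open>c\<close> is that of \<open>A\<close>, hence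
        defined in \<open>P\<close>, and therefore cannot occur in \<open>R\<close>.\<close>
      have "c \<notin> R"
        using ext Suc.prems(2) unfolding pred[symmetric] extends_def occurring_rels_def by blast
      then have cP: "c \<in> P" using c by simp
      \<comment> \<open>The instantiated body is handled prefix by prefix, adding one literal at the
        right each time; prefixes of the resolvent stay in the class.\<close>
      have "ldnf_terminates PR (subst_query \<theta> B1)" if "B = B1 @ B2" for B1 B2
        using that
      proof (induction B1 arbitrary: B2 rule: rev_induct)
        case Nil
        then show ?case by (simp add: ldnf_terminates_Nil)
      next
        case (snoc l B1)
        have inC: "subst_query \<theta> B1 @ [subst_lit \<theta> l] \<in> C"
          using closed_class_prefix[OF C, of _ "subst_query \<theta> B2"] QC Q snoc.prems by simp
        have "bounded_after n (subst_query \<theta> B1) (subst_lit \<theta> l)"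
          using bounded_after_body[OF Suc.prems(1,3) cP _ mgu, of B1 l B2] HB snoc.prems by simp
        moreover have "ldnf_terminates PR (subst_query \<theta> B1)"
          using snoc.IH[of "l # B2"] snoc.prems by simp
        \<comment> \<open>The empty query is true in \<open>M\<close>, so here the invariant is an
          unconditional bound by \<open>n\<close> and the outer induction hypothesis
          applies.\<close>
        moreover have "ldnf_terminates PR [l]" if "[l] \<in> C" "bounded_after n [] l" for l
          using ldnf_terminates_literal[of "bounded_by n" l] Suc.IH that
          by (auto simp: bounded_after_def bounded_by_def true_in_def)
        ultimately have "ldnf_terminates PR (subst_query \<theta> B1 @ [subst_lit \<theta> l])"
          using inC ldnf_terminates_snoc[OF C, of "bounded_after n"]
            bounded_after_resolve bounded_after_neg by blast
        then show ?case by simp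
      qed
      then show ?thesis using Q by simp
    qed
  qed
qed

lemma bounded_imp_bounded_by:
  assumes "wf_atom \<Sigma> A" "bounded \<Sigma> lev A"
  shows "\<exists>n. bounded_by n A"
proof -
  obtain n where "\<forall>k\<in>lev ` ground_instances \<Sigma> A. k < n"
    using assms(2) finite_nat_set_iff_bounded unfolding bounded_def by blast
  then show ?thesis
    unfolding bounded_by_def using ground_subst_instance assms(1) by blast
qed

lemma ldnf_terminates_atom:
  assumes "[Pos A] \<in> C" "pred A \<in> defined_rels P"
  shows "ldnf_terminates PR [Pos A]"
proof -
  have "wf_atom \<Sigma> A" using closed_class_wf[OF C assms(1)] by simp
  then show ?thesis
    using bounded_imp_bounded_by bdd ldnf_terminates_bounded_atom assms by blast
qed

text \<open>The same extension by single literals, now with the trivial invariant: atoms reached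
  stay in the class, and boundedness of those defined in \<open>P\<close> is assumed throughout
  it.\<close>

lemma ldnf_terminates_class: "Q \<in> C \<Longrightarrow> ldnf_terminates PR Q"
proof (induction Q rule: rev_induct)
  case Nil
  show ?case by (rule ldnf_terminates_Nil)
next
  case (snoc l Q)
  have "ldnf_terminates PR Q"
    using snoc closed_class_prefix[OF C] ldnf_terminates_Nil by blast
  moreover have "ldnf_terminates PR [l]" if "[l] \<in> C" for l
    using ldnf_terminates_literal[of "\<lambda>_. True" l] ldnf_terminates_atom that by blast
  ultimately show ?case
    using ldnf_terminates_snoc[OF C, of "\<lambda>_ _. True" Q l] snoc.prems by blast
qed

end

theorem theorem9:
  fixes \<Sigma> :: "('f, 'p) lang"
    and P R :: "('f, 'p) clause set"
    and M :: "('f, 'p, 'd) interp"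
    and C :: "('f, 'p) query set"
    and lev :: "('f, 'p) atom \<Rightarrow> nat"
  assumes "has_constant \<Sigma>"
    and "program \<Sigma> P" and "program \<Sigma> R"
    and "extends P R"
    and "complete_model \<Sigma> M (P \<union> R)"
    and "closed_class \<Sigma> (P \<union> R) C"
    and "acceptable \<Sigma> P lev M"
    and "\<forall>Q\<in>C. all_ldnf_derivations_finite R Q"
    and "\<forall>A. [Pos A] \<in> C \<and> pred A \<in> defined_rels P \<longrightarrow> bounded \<Sigma> lev A"
  shows "\<forall>Q\<in>C. all_ldnf_derivations_finite (P \<union> R) Q"
proof -
  interpret acceptable_extension \<Sigma> P R M C lev
    using assms by unfold_locales (auto simp: all_ldnf_derivations_finite_iff)
  show ?thesis using ldnf_terminates_class by (simp add: all_ldnf_derivations_finite_iff)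
qed

end
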